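(* Let $\ell,m\ge 3$ be integers with $(\ell-2)(m-2)>4$, and let $D_{\ell,m}(X)\in\mathbb Z[X]$ be the polynomial defined as follows. If $m=2w$ is even, $$D_{\ell,m}(X)=1-(\ell-2)X-(\ell-2)X^2-\dots-(\ell-2)X^{w-1}+X^{w};$$ if $m=2w+1$ is odd, $$D_{\ell,m}(X)=1-(\ell-2)X-\dots-(\ell-2)X^{w-1}-(\ell-4)X^{w}-(\ell-2)X^{w+1}-\dots-(\ell-2)X^{2w-1}+X^{2w}.$$ Then $D_{\ell,m}$ is a reciprocal Salem polynomial. Moreover, let $E_{\ell,m}=D_{\ell,m}/(X+1)$ if $m\equiv 2\pmod 4$ and $E_{\ell,m}=D_{\ell,m}$ otherwise. Then $E_{\ell,m}$ is irreducible over $\mathbb Q$, except in the following cases: (1) $\ell=3$ and $m\equiv 4\pmod{12}$, where $E_{\ell,m}$ has a factor $X^2-X+1$; (2) $\ell=3$ and $m\equiv 3\pmod 6$, where there is a factor $X^2+X+1$; (3) $\ell=3$ and $m\equiv 5\pmod{20}$, where there is a factor $X^4-X^3+X^2-X+1$; (4) $\ell=4$ and $m\equiv 3\pmod 8$, where there is a factor $X^2+1$; (5) $\ell=5$ and $m\equiv 3\pmod{12}$, where there is a factor $X^2-X+1$.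
   Context: For $\ell,m\ge3$, $X_{\ell,m}$ denotes the $\ell$-regular graph which is the $1$-skeleton of the tessellation of the sphere, Euclidean plane or hyperbolic plane (according as $(\ell-2)(m-2)<4$, $=4$, $>4$) by regular $m$-gons, $\ell$ meeting at each vertex. With a base vertex $*$ and $|x|$ the graph distance from $x$ to $*$, its growth series is $F_{\ell,m}(X)=\sum_{x}X^{|x|}$. By a result of Floyd and Plotnick, $F_{\ell,m}=N_{\ell,m}/D_{\ell,m}$, where $D_{\ell,m}$ is the polynomial in the claim and $N_{\ell,m}=1+2X+\dots+2X^{w-1}+X^w$ for $m=2w$, $N_{\ell,m}=1+2X+\dots+2X^{w-1}+4X^w+2X^{w+1}+\dots+2X^{2w-1}+X^{2w}$ for $m=2w+1$; $D_{\ell,m}$ is "the denominator of the growth series". A polynomial $f=f_0+\dots+f_nX^n$ ($f_n\ne0$) is reciprocal if $f_i=f_{n-i}$ for all $i$. A Salem polynomial is a monic $f\in\mathbb Z[X]$ having exactly one root $\lambda$ with $|\lambda|>1$, this root being simple. *)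

theory Defs
  imports "HOL-Computational_Algebra.Computational_Algebra"
begin

text \<open>Denominator of the growth series of X_{l,m}.\<close>
definition D_poly :: "nat \<Rightarrow> nat \<Rightarrow> int poly" where
  "D_poly l m =
    (if even m then
       (let w = m div 2 in
          monom 1 0 + (\<Sum>i\<in>{1..<w}. monom (- (int l - 2)) i) + monom 1 w)
     else
       (let w = m div 2 in
          monom 1 0
          + (\<Sum>i\<in>{1..<2*w}. monom (if i = w then - (int l - 4) else - (int l - 2)) i)
          + monom 1 (2*w)))"

definition E_poly :: "nat \<Rightarrow> nat \<Rightarrow> int poly" where
  "E_poly l m = (if m mod 4 = 2 then D_poly l m div [:1, 1:] else D_poly l m)"

definition reciprocal_poly :: "'a::zero poly \<Rightarrow> bool" where
  "reciprocal_poly f \<longleftrightarrow> (\<forall>i\<le>degree f. coeff f i = coeff f (degree f - i))"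

definition salem_poly :: "int poly \<Rightarrow> bool" where
  "salem_poly f \<longleftrightarrow> lead_coeff f = 1 \<and>
     (\<exists>!z::complex. poly (map_poly of_int f) z = 0 \<and> cmod z > 1) \<and>
     (\<forall>z::complex. poly (map_poly of_int f) z = 0 \<and> cmod z > 1 \<longrightarrow>
        order z (map_poly of_int f) = 1)"

end

theory Submission
  imports Defs Complex_Main
begin

text \<open>
  Write \<open>q = l - 2\<close> and \<open>t = X^w\<close>. Multiplying by \<open>X - 1\<close> collapses the denominator to
  \<open>(X - 1)(t + 1) - q(t - X)\<close> for \<open>m = 2w\<close> and to \<open>(X - 1)(t + 1)^2 - q(t^2 - X)\<close> for \<open>m = 2w + 1\<close>.
  On the unit circle this is a real trigonometric function which alternates in sign at the points
  \<open>X = exp(2 pi i j / d)\<close>, \<open>0 < j < d\<close>, where \<open>d\<close> is the degree. That gives \<open>d - 2\<close> roots on the circle; as the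
  value at \<open>1\<close> is negative, the remaining two are real, \<open>x > 1\<close> and \<open>1/x\<close>, and all roots are simple.

  A rational factor not vanishing at \<open>x\<close> has all its roots in the closed unit disc, so by Kronecker's theorem
  they are roots of unity. A root of unity \<open>z\<close> is conjugate to \<open>z^2\<close>, \<open>- z^2\<close> or \<open>- z\<close>, according
  as its order is odd, twice odd, or divisible by 4. Eliminating between the equations for \<open>z\<close> and
  for its conjugate determines \<open>t\<close> and \<open>q\<close>: for even \<open>m\<close> by factoring, for odd \<open>m\<close> through a
  polynomial condition on the real number \<open>y = t + 1/t\<close> of \<open>[-2, 2]\<close>. Only the exceptional cases and
  the simple root \<open>z = - 1\<close>, which is divided out, survive.
\<close>

section \<open>Polynomials with simple roots and Kronecker's theorem\<close>

abbreviation ieval :: "int poly \<Rightarrow> complex \<Rightarrow> complex" where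
  "ieval f z \<equiv> poly (map_poly of_int f) z"

section \<open>Integer polynomials evaluated over larger rings\<close>

lemma map_poly_of_int_add: "map_poly of_int (f + g) = (map_poly of_int f + map_poly of_int g :: 'a::ring_1 poly)"
  by (intro poly_eqI) (simp add: coeff_map_poly)

lemma map_poly_of_int_diff: "map_poly of_int (f - g) = (map_poly of_int f - map_poly of_int g :: 'a::ring_1 poly)"
  by (intro poly_eqI) (simp add: coeff_map_poly)

lemma map_poly_of_int_mult: "map_poly of_int (f * g) = (map_poly of_int f * map_poly of_int g :: 'a::comm_ring_1 poly)"
  by (intro poly_eqI) (simp add: coeff_map_poly coeff_mult)

lemma map_poly_of_int_power: "map_poly of_int (f ^ n) = (map_poly of_int f ^ n :: 'a::comm_ring_1 poly)"
  by (induction n) (simp_all add: map_poly_of_int_mult)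

lemma map_poly_of_int_sum:
  "map_poly of_int (\<Sum>i\<in>A. f i) = (\<Sum>i\<in>A. map_poly of_int (f i) :: 'a::ring_1 poly)"
  by (induction A rule: infinite_finite_induct) (simp_all add: map_poly_of_int_add)

lemma map_poly_of_int_prod_mset:
  "map_poly of_int (prod_mset A) = (\<Prod>f\<in>#A. map_poly of_int f :: 'a::comm_ring_1 poly)"
  by (induction A) (simp_all add: map_poly_of_int_mult)

lemma map_poly_of_int_pcompose:
  "map_poly of_int (pcompose f g) = (pcompose (map_poly of_int f) (map_poly of_int g) :: 'a::comm_ring_1 poly)"
  by (induction f) (simp_all add: pcompose_pCons map_poly_pCons map_poly_of_int_add map_poly_of_int_mult)

lemmas map_poly_of_int_hom =
  map_poly_of_int_add map_poly_of_int_diff map_poly_of_int_mult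
  map_poly_of_int_power map_poly_of_int_sum map_poly_pCons map_poly_monom map_poly_smult

lemma degree_map_poly_of_int [simp]:
  "degree (map_poly of_int f :: 'a::{ring_1,ring_char_0} poly) = degree f"
  by (intro degree_map_poly) auto

lemma map_poly_of_int_eq_0_iff [simp]:
  "(map_poly of_int f :: 'a::{ring_1,ring_char_0} poly) = 0 \<longleftrightarrow> f = 0"
  by (intro map_poly_eq_0_iff) auto

lemma ieval_dvd:
  assumes "g dvd f" "ieval g z = 0"
  shows "ieval f z = 0"
  using assms by (auto simp: map_poly_of_int_hom elim!: dvdE)

lemma finite_ieval_roots: "f \<noteq> 0 \<Longrightarrow> finite {z. ieval f z = 0}"
  by (rule poly_roots_finite) simp

lemma abs_lead_coeff_dvd:
  fixes h f :: "int poly"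
  assumes "h dvd f" "\<bar>lead_coeff f\<bar> = 1"
  shows "\<bar>lead_coeff h\<bar> = 1"
proof -
  from assms(1) obtain g where "f = h * g" by auto
  with assms(2) have "\<bar>lead_coeff h * lead_coeff g\<bar> = 1" by (simp add: lead_coeff_mult)
  then show ?thesis by (rule abs_zmult_eq_1)
qed

text \<open>Pseudo-division multiplies \<open>f\<close> by a power \<open>c\<close> of the leading
  coefficient. That power is 1 or -1, so multiplying by \<open>c\<close> once more recovers
  \<open>f\<close>.\<close>

lemma division_by_monic:
  fixes h f :: "int poly"
  assumes "\<bar>lead_coeff h\<bar> = 1"
  obtains q r where "f = h * q + r" "r = 0 \<or> degree r < degree h"
proof -
  obtain q r where qr: "pseudo_divmod f h = (q, r)" by fastforce
  have h: "h \<noteq> 0" using assms by auto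
  define n where "n = Suc (degree f) - degree h"
  define c where "c = lead_coeff h ^ n"
  from pseudo_divmod[OF h qr] have *: "smult c f = h * q + r" "r = 0 \<or> degree r < degree h"
    by (auto simp: c_def n_def)
  have "\<bar>c\<bar> = 1" using assms by (simp add: c_def power_abs)
  then have "c * c = 1" by (auto simp: abs_if split: if_splits)
  then have "f = smult c (smult c f)" by simp
  also have "\<dots> = h * smult c q + smult c r" by (simp add: * smult_add_right)
  finally show ?thesis using that[of "smult c q" "smult c r"] *(2)
    by (metis degree_smult_eq smult_eq_0_iff)
qed

text \<open>Counting distinct complex roots, rather than using derivatives, lets the property pass
  to factors by comparing cardinalities.\<close>

definition has_simple_roots :: "int poly \<Rightarrow> bool" where
  "has_simple_roots f \<longleftrightarrow> f \<noteq> 0 \<and> card {z. ieval f z = 0} = degree f"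

text \<open>No factor has more roots than its degree, and together they must supply
  \<open>degree h + degree g\<close> roots, so neither can fall short.\<close>

lemma has_simple_roots_dvd:
  assumes "has_simple_roots f" "h dvd f"
  shows "has_simple_roots h"
proof -
  from assms(2) obtain g where g: "f = h * g" by auto
  have nz: "h \<noteq> 0" "g \<noteq> 0" using assms g by (auto simp: has_simple_roots_def)
  have "degree h + degree g = card {z. ieval f z = 0}"
    using assms nz by (simp add: has_simple_roots_def g degree_mult_eq)
  also have "{z. ieval f z = 0} = {z. ieval h z = 0} \<union> {z. ieval g z = 0}"
    by (auto simp: g map_poly_of_int_hom)
  also have "card \<dots> \<le> card {z. ieval h z = 0} + card {z. ieval g z = 0}"
    by (rule card_Un_le)
  finally show ?thesis
    using card_poly_roots_bound[of "map_poly of_int h :: complex poly"]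
      card_poly_roots_bound[of "map_poly of_int g :: complex poly"] nz
    by (simp add: has_simple_roots_def)
qed

text \<open>A common root would be counted twice, leaving the product fewer distinct roots than its
  degree.\<close>

lemma has_simple_roots_square_free:
  assumes "has_simple_roots (g * h)" "ieval g z = 0"
  shows "ieval h z \<noteq> 0"
proof
  assume hz: "ieval h z = 0"
  let ?R = "\<lambda>f. {z. ieval f z = 0}"
  have nz: "h \<noteq> 0" "g \<noteq> 0" using assms by (auto simp: has_simple_roots_def)
  have "degree g + degree h = card (?R (g * h))"
    using assms nz by (simp add: has_simple_roots_def degree_mult_eq)
  also have "?R (g * h) = ?R g \<union> (?R h - {z})"
    using assms(2) by (auto simp: map_poly_of_int_hom)
  also have "card \<dots> \<le> card (?R g) + card (?R h - {z})"
    by (rule card_Un_le)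
  also have "card (?R h - {z}) < card (?R h)"
    using hz nz by (intro psubset_card_mono finite_ieval_roots) auto
  finally show False
    using card_poly_roots_bound[of "map_poly of_int h :: complex poly"]
      card_poly_roots_bound[of "map_poly of_int g :: complex poly"] nz
    by simp
qed

section \<open>Finiteness by interpolation and Kronecker's theorem\<close>

lemma finite_int_polys_bounded_coeffs:
  "finite {r :: int poly. degree r < d \<and> (\<forall>i<d. \<bar>coeff r i\<bar> \<le> C)}"
proof -
  have "r \<in> Poly ` {xs. set xs \<subseteq> {-C..C} \<and> length xs = d}"
    if r: "degree r < d" "\<forall>i<d. \<bar>coeff r i\<bar> \<le> C" for r
  proof
    show "r = Poly (map (coeff r) [0..<d])"
      using r(1) by (intro poly_eqI) (auto simp: nth_default_def coeff_eq_0)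
    show "map (coeff r) [0..<d] \<in> {xs. set xs \<subseteq> {-C..C} \<and> length xs = d}"
      using r(2) by (auto simp: abs_le_iff)
  qed
  then have "{r. degree r < d \<and> (\<forall>i<d. \<bar>coeff r i\<bar> \<le> C)}
      \<subseteq> Poly ` {xs. set xs \<subseteq> {-C..C} \<and> length xs = d}"
    by blast
  moreover have "finite {xs. set xs \<subseteq> {-C..C} \<and> length xs = d}"
    by (intro finite_lists_length_eq) auto
  ultimately show ?thesis by (meson finite_surj)
qed

text \<open>Lagrange interpolation recovers a polynomial of degree below \<open>d\<close> from its
  values at \<open>d\<close> points, so bounded values bound the coefficients; being integers, these
  have finitely many choices.\<close>

lemma finite_int_polys_bounded_values:
  assumes R: "finite R" "card R = d"
  shows "finite {r :: int poly. degree r < d \<and> (\<forall>a\<in>R. cmod (ieval r a) \<le> 1)}"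
proof -
  \<comment> \<open>\<open>L a\<close> is the Lagrange basis polynomial at the node
    \<open>a\<close>. \<open>C\<close> adds the moduli of the coefficients of all of them, so one
    bound serves every index.\<close>
  define L where "L a = (\<Prod>b\<in>R-{a}. smult (1 / (a - b)) [:-b, 1:])" for a
  define C where "C = (\<Sum>i<d. \<Sum>a\<in>R. cmod (coeff (L a) i))"
  have L: "poly (L a) b = (if a = b then 1 else 0)" if "a \<in> R" "b \<in> R" for a b
  proof (cases "a = b")
    case True
    have "poly (smult (1 / (b - c)) [:-c, 1:]) b = 1" if "c \<in> R - {b}" for c
      using that by (auto simp flip: diff_divide_distrib)
    with True show ?thesis by (simp add: L_def poly_prod del: poly_smult poly_pCons)
  next
    case False
    have "poly (L a) b = (\<Prod>c\<in>R-{a}. (b - c) / (a - c))"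
      by (simp add: L_def poly_prod diff_divide_distrib)
    also have "\<dots> = 0" using False that R by (intro prod_zero) auto
    finally show ?thesis using False by simp
  qed
  have degL: "degree (L a) < d" if "a \<in> R" for a
  proof -
    have "degree (L a) \<le> (\<Sum>b\<in>R-{a}. degree (smult (1 / (a - b)) [:-b, 1:]))"
      unfolding L_def using degree_prod_sum_le[of "R - {a}" "\<lambda>b. smult (1 / (a - b)) [:-b, 1:]"] R
      by (simp add: comp_def)
    also have "\<dots> \<le> (\<Sum>b\<in>R-{a}. 1)"
      by (intro sum_mono) (simp add: degree_smult_eq)
    also have "\<dots> = card (R - {a})" by simp
    also have "\<dots> < card R" using R(1) that by (rule card_Diff1_less)
    also have "\<dots> = d" by (rule R(2))
    finally show ?thesis .
  qed
  have "\<bar>coeff r i\<bar> \<le> \<lceil>C\<rceil>"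
    if r: "degree r < d" "\<forall>a\<in>R. cmod (ieval r a) \<le> 1" and i: "i < d" for r i
  proof -
    let ?r = "map_poly of_int r :: complex poly"
    define S where "S = (\<Sum>a\<in>R. smult (ieval r a) (L a))"
    have "?r = S"
    proof (rule poly_eqI_degree[where A = R])
      show "poly ?r x = poly S x" if "x \<in> R" for x
      proof -
        have "poly S x = (\<Sum>a\<in>R. if a = x then ieval r a else 0)"
          unfolding S_def poly_sum using L that by (intro sum.cong) auto
        then show ?thesis using that R by simp
      qed
      show "card R > degree ?r" using r R by simp
      have "degree S \<le> d - 1"
        unfolding S_def
      proof (rule degree_sum_le[OF R(1)])
        show "degree (smult (ieval r a) (L a)) \<le> d - 1" if "a \<in> R" for a
          using degL[OF that] degree_smult_le[of "ieval r a" "L a"] by linarith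
      qed
      then show "card R > degree S" using i R by simp
    qed
    then have "coeff ?r i = coeff S i" by simp
    also have "coeff S i = (\<Sum>a\<in>R. ieval r a * coeff (L a) i)"
      by (simp add: S_def coeff_sum)
    finally have "of_int (coeff r i) = (\<Sum>a\<in>R. ieval r a * coeff (L a) i)"
      by (simp add: coeff_map_poly)
    then have "cmod (of_int (coeff r i)) = cmod (\<Sum>a\<in>R. ieval r a * coeff (L a) i)"
      by (rule arg_cong)
    then have "real_of_int \<bar>coeff r i\<bar> = cmod (\<Sum>a\<in>R. ieval r a * coeff (L a) i)"
      by simp
    also have "\<dots> \<le> (\<Sum>a\<in>R. cmod (coeff (L a) i))"
      using r(2) by (intro sum_norm_le) (simp add: norm_mult mult_left_le_one_le)
    also have "\<dots> \<le> C"
      unfolding C_def using i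
      by (intro member_le_sum[of i "{..<d}" "\<lambda>i. \<Sum>a\<in>R. cmod (coeff (L a) i)"]) (auto intro: sum_nonneg)
    finally show ?thesis by linarith
  qed
  then show ?thesis
    by (intro finite_subset[OF _ finite_int_polys_bounded_coeffs[of d "\<lceil>C\<rceil>"]]) auto
qed

text \<open>Kronecker's pigeonhole argument modulo \<open>h\<close>: the remainders of the powers of
  \<open>p\<close> are bounded by 1 at the roots of \<open>h\<close>, so two of them coincide.
  Primality of \<open>h\<close> then splits \<open>p ^ i * (p ^ (j - i) - 1)\<close>. Taking
  \<open>p = X\<close> gives the classical statement on roots of unity.\<close>

lemma kronecker_dvd:
  fixes h p :: "int poly"
  assumes h: "prime_elem h" "\<bar>lead_coeff h\<bar> = 1" "has_simple_roots h"
    and p: "\<And>z. ieval h z = 0 \<Longrightarrow> cmod (ieval p z) \<le> 1"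
  shows "h dvd p \<or> (\<exists>N>0. h dvd p ^ N - 1)"
proof -
  define R where "R = {z. ieval h z = 0}"
  define d where "d = degree h"
  have R: "finite R" "card R = d"
    using h(2,3) by (auto simp: R_def d_def has_simple_roots_def intro!: finite_ieval_roots)
  have d: "d > 0"
  proof (rule ccontr)
    assume "\<not> d > 0"
    then obtain c where "h = [:c:]" by (auto simp: d_def elim: degree_eq_zeroE)
    with h(1,2) show False by (auto simp: is_unit_const_poly_iff prime_elem_def)
  qed
  have "\<exists>r. degree r < d \<and> h dvd p ^ n - r" for n
  proof -
    obtain q r where "p ^ n = h * q + r" "r = 0 \<or> degree r < degree h"
      using division_by_monic[OF h(2)] .
    then show ?thesis using d by (intro exI[of _ r]) (auto simp: d_def)
  qed
  then obtain r where r: "\<And>n. degree (r n) < d" "\<And>n. h dvd p ^ n - r n" by metis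
  have "range r \<subseteq> {r. degree r < d \<and> (\<forall>a\<in>R. cmod (ieval r a) \<le> 1)}"
  proof (safe, rule r(1))
    fix n a assume a: "a \<in> R"
    then have "ieval (p ^ n - r n) a = 0" using ieval_dvd[OF r(2)] by (simp add: R_def)
    then have "ieval (r n) a = ieval p a ^ n" by (simp add: map_poly_of_int_hom)
    then show "cmod (ieval (r n) a) \<le> 1"
      using p a by (simp add: norm_power power_le_one R_def)
  qed
  then have "finite (range r)"
    using finite_int_polys_bounded_values[OF R] by (rule finite_subset)
  then have "\<not> inj r" using finite_imageD infinite_UNIV_nat by blast
  then obtain i j where ij: "i < j" "r i = r j"
    by (metis injI linorder_neqE_nat)
  have "h dvd (p ^ j - r j) - (p ^ i - r i)" by (intro dvd_diff r)
  also have "\<dots> = p ^ i * (p ^ (j - i) - 1)"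
    using ij by (simp add: algebra_simps flip: power_add)
  finally have "h dvd p ^ i \<or> h dvd p ^ (j - i) - 1"
    using h(1) by (simp add: prime_elem_dvd_mult_iff)
  then show ?thesis using prime_elem_dvd_power[OF h(1)] ij(1) by (auto intro!: exI[of _ "j - i"])
qed

lemma ieval_root_exists:
  assumes "degree h > 0"
  obtains z where "ieval h z = 0"
proof -
  have "\<not> constant (poly (map_poly of_int h :: complex poly))"
    using assms by (simp add: constant_degree)
  then show ?thesis using fundamental_theorem_of_algebra that by blast
qed

text \<open>The second alternative of \<open>kronecker_dvd\<close> would make
  \<open>ieval p z\<close> a root of unity, hence of modulus 1.\<close>

lemma kronecker_dvd_strict:
  fixes h p :: "int poly"
  assumes h: "prime_elem h" "\<bar>lead_coeff h\<bar> = 1" "has_simple_roots h" "degree h > 0"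
    and p: "\<And>z. ieval h z = 0 \<Longrightarrow> cmod (ieval p z) < 1"
  shows "h dvd p"
proof (rule ccontr)
  assume "\<not> h dvd p"
  with kronecker_dvd[OF h(1-3), of p] p obtain N where N: "N > 0" "h dvd p ^ N - 1"
    using less_imp_le by blast
  obtain z where z: "ieval h z = 0" using ieval_root_exists[OF h(4)] .
  have "ieval p z ^ N = 1" using ieval_dvd[OF N(2) z] by (simp add: map_poly_of_int_hom)
  moreover have "cmod (ieval p z) ^ N < 1" using p[OF z] N(1) by (simp add: power_less_one_iff)
  ultimately show False by (metis less_irrefl norm_one norm_power)
qed

section \<open>Conjugates of roots of unity\<close>

lemma prime_dvd_power_add_diff:
  fixes u v :: "'a :: comm_ring_1"
  assumes p: "prime p"
  shows "of_nat p dvd (u + v) ^ p - u ^ p - v ^ p"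
proof -
  have p0: "p > 0" using p by (simp add: prime_gt_0_nat)
  have "(u + v) ^ p = (\<Sum>k\<le>p. of_nat (p choose k) * u ^ k * v ^ (p - k))"
    by (rule binomial_ring)
  also have "{..p} = insert 0 (insert p {1..<p})" using p0 by auto
  also have "(\<Sum>k\<in>insert 0 (insert p {1..<p}). of_nat (p choose k) * u ^ k * v ^ (p - k)) =
      v ^ p + (u ^ p + (\<Sum>k\<in>{1..<p}. of_nat (p choose k) * u ^ k * v ^ (p - k)))"
    using p0 by simp
  finally have "(u + v) ^ p - u ^ p - v ^ p =
      (\<Sum>k\<in>{1..<p}. of_nat (p choose k) * u ^ k * v ^ (p - k))" by simp
  also have "of_nat p dvd \<dots>"
  proof (rule dvd_sum)
    fix k assume k: "k \<in> {1..<p}"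
    have "p dvd (p choose k)" using p k by (intro dvd_choose_prime) auto
    then show "(of_nat p :: 'a) dvd of_nat (p choose k) * u ^ k * v ^ (p - k)"
      by (auto simp: mult.assoc elim!: dvdE)
  qed
  finally show ?thesis .
qed

lemma prime_dvd_int_power_diff:
  fixes a :: int
  assumes p: "prime p"
  shows "int p dvd a ^ p - a"
proof (induction a rule: int_induct[where k = 0])
  case base
  then show ?case using p by (simp add: power_0_left prime_gt_0_nat)
next
  case (step1 i)
  have "int p dvd ((i + 1) ^ p - i ^ p - 1 ^ p) + (i ^ p - i)"
    using prime_dvd_power_add_diff[OF p, of i 1] step1 by (intro dvd_add) simp_all
  then show ?case by (simp add: algebra_simps)
next
  case (step2 i)
  have "int p dvd (i ^ p - i) - (((i - 1) + 1) ^ p - (i - 1) ^ p - 1 ^ p)"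
    using prime_dvd_power_add_diff[OF p, of "i - 1" 1] step2 by (intro dvd_diff[OF step2(2)]) simp_all
  then show ?case by (simp add: algebra_simps)
qed

text \<open>Modulo \<open>p\<close>, the p-th power is additive and fixes integer constants by
  Fermat, so the congruence propagates through the coefficients by induction.\<close>

lemma prime_dvd_pcompose_monom_diff_power:
  fixes f :: "int poly"
  assumes p: "prime p"
  shows "of_nat p dvd pcompose f (monom 1 p) - f ^ p"
proof (induction f)
  case 0
  then show ?case using p by (simp add: power_0_left prime_gt_0_nat)
next
  case (pCons a f)
  let ?X = "monom 1 p :: int poly" and ?Y = "[:0, 1:] :: int poly"
  have f: "pCons a f = [:a:] + ?Y * f" by simp
  have X: "?X = ?Y ^ p" by (simp add: monom_altdef)
  obtain c where c: "a ^ p - a = int p * c" using prime_dvd_int_power_diff[OF p, of a] by blast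
  have "[:a:] ^ p - [:a:] = of_nat p * [:c:]"
    using c by (simp add: of_nat_poly poly_const_pow mult.commute)
  then have *: "of_nat p dvd [:a:] ^ p - [:a:]" by (rule dvdI)
  \<comment> \<open>The defect splits into that of the tail, that of Fermat for \<open>a\<close>,
    and that of additivity.\<close>
  have "pcompose (pCons a f) ?X - (pCons a f) ^ p =
      ?X * (pcompose f ?X - f ^ p) - ([:a:] ^ p - [:a:])
      - (([:a:] + ?Y * f) ^ p - [:a:] ^ p - (?Y * f) ^ p)"
    unfolding f[symmetric]
    by (simp only: pcompose_pCons X power_mult_distrib) (simp add: algebra_simps)
  also have "of_nat p dvd \<dots>"
    by (intro dvd_diff dvd_mult pCons * prime_dvd_power_add_diff p)
  finally show ?case .
qed

section \<open>Minimal polynomials and conjugation of roots of unity\<close>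

lemma ieval_bounded_unit_circle:
  obtains L :: nat where "\<And>z. cmod z = 1 \<Longrightarrow> cmod (ieval f z) \<le> L"
proof -
  define S where "S = (\<Sum>i\<le>degree f. \<bar>real_of_int (coeff f i)\<bar>)"
  have "cmod (ieval f z) \<le> real (nat \<lceil>S\<rceil>)" if "cmod z = 1" for z
  proof -
    have "cmod (ieval f z) \<le> (\<Sum>i\<le>degree f. cmod (of_int (coeff f i) * z ^ i))"
      by (simp add: poly_altdef coeff_map_poly norm_sum)
    also have "\<dots> = S" by (simp add: S_def norm_mult norm_power that)
    also have "\<dots> \<le> real (nat \<lceil>S\<rceil>)" by (rule real_nat_ceiling_ge)
    finally show ?thesis .
  qed
  with that show ?thesis .
qed

text \<open>A polynomial of least degree vanishing at \<open>z\<close> has a prime factor that still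
  vanishes there. It need not be monic, so divisibility comes from pseudo-division, and primality
  removes the integer factor this introduces.\<close>

lemma minimal_int_poly:
  assumes g: "g \<noteq> 0" "ieval g z = 0"
  obtains h where "prime_elem h" "degree h > 0" "ieval h z = 0"
    "\<And>f. ieval f z = 0 \<Longrightarrow> h dvd f"
proof -
  define P where "P = (\<lambda>h. h \<noteq> 0 \<and> ieval h z = 0)"
  define n where "n = (LEAST n. \<exists>h. P h \<and> degree h = n)"
  have "\<exists>n h. P h \<and> degree h = n" using g by (auto simp: P_def)
  from LeastI_ex[OF this] obtain f0 where f0: "P f0" "degree f0 = n"
    unfolding n_def by blast
  have min: "degree h \<ge> n" if "P h" for h
    unfolding n_def using that by (intro Least_le) auto
  have "(\<Prod>h\<in>#prime_factorization f0. ieval h z) = ieval (prod_mset (prime_factorization f0)) z"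
    by (simp add: map_poly_of_int_prod_mset poly_prod_mset image_mset.compositionality comp_def)
  also have "\<dots> = 0"
  proof (rule ieval_dvd[of f0])
    have "normalize (prod_mset (prime_factorization f0)) = normalize f0"
      using f0 by (intro prod_mset_prime_factorization_weak) (auto simp: P_def)
    then show "f0 dvd prod_mset (prime_factorization f0)"
      by (metis dvd_normalize_iff dvd_refl normalize_dvd_iff)
    show "ieval f0 z = 0" using f0 by (simp add: P_def)
  qed
  finally obtain h where h: "h \<in># prime_factorization f0" "ieval h z = 0" by auto
  then have hp: "prime_elem h" "h dvd f0" by (auto dest: in_prime_factors_imp_prime)
  have "P h" using h(2) hp(1) by (auto simp: P_def)
  then have hn: "degree h = n"
    using min[of h] dvd_imp_degree_le[OF hp(2)] f0 by (auto simp: P_def)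
  have pos: "degree h > 0"
  proof (rule ccontr)
    assume "\<not> degree h > 0"
    then obtain c where "h = [:c:]" by (auto elim: degree_eq_zeroE)
    with h(2) hp(1) show False by (auto simp: map_poly_pCons)
  qed
  have "h dvd f" if f: "ieval f z = 0" for f
  proof -
    have hnz: "h \<noteq> 0" using hp(1) by auto
    obtain q r where "pseudo_divmod f h = (q, r)" by fastforce
    from pseudo_divmod[OF hnz this] obtain c
      where c: "c = lead_coeff h ^ (Suc (degree f) - degree h)"
        "smult c f = h * q + r" "r = 0 \<or> degree r < degree h" by blast
    have "c \<noteq> 0" using hnz by (simp add: c(1))
    have "ieval (smult c f) z = 0" using f by (simp add: map_poly_smult)
    then have "ieval r z = 0" using h(2) by (simp add: c(2) map_poly_of_int_hom)
    then have "r = 0" using min[of r] c(3) hn by (cases "r = 0") (auto simp: P_def)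
    then have "h dvd [:c:] * f" using c(2) by simp
    moreover have "\<not> h dvd [:c:]"
      using dvd_imp_degree_le[of h "[:c:]"] pos \<open>c \<noteq> 0\<close> by auto
    ultimately show ?thesis using prime_elem_dvd_multD[OF hp(1)] by blast
  qed
  with that hp(1) pos h(2) show ?thesis by blast
qed

lemma degree_monom_minus_1: "n > 0 \<Longrightarrow> degree (monom 1 n - 1 :: int poly) = n"
  using degree_add_eq_left[of "-1" "monom 1 n :: int poly"] by (simp add: degree_monom_eq)

lemma has_simple_roots_unity:
  assumes "n > 0"
  shows "has_simple_roots (monom 1 n - 1)"
proof -
  have "degree (monom 1 n - 1 :: int poly) = n"
    using assms by (simp add: degree_monom_minus_1)
  moreover have "{z. ieval (monom 1 n - 1) z = 0} = {z. z ^ n = 1}"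
    by (simp add: map_poly_of_int_hom poly_monom)
  ultimately show ?thesis using assms by (auto simp: has_simple_roots_def card_roots_unity_eq)
qed

text \<open>At a root \<open>x\<close> of the minimal polynomial \<open>h\<close>, the quotient
  \<open>s\<close> of \<open>f(X^p) - f ^ p\<close> by \<open>p\<close> takes the value
  \<open>f(x ^ p) / p\<close>. For \<open>p > L\<close> this is below 1 in modulus, so
  \<open>h\<close> divides \<open>s\<close> and the value at \<open>z\<close> is zero.\<close>

lemma unity_root_prime_conj:
  assumes z: "z ^ n = 1" "n > 0" "ieval f z = 0"
    and L: "\<And>x. cmod x = 1 \<Longrightarrow> cmod (ieval f x) \<le> real L"
    and p: "prime p" "p > L"
  shows "ieval f (z ^ p) = 0"
proof -
  let ?u = "monom 1 n - 1 :: int poly"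
  have u: "has_simple_roots ?u" "?u \<noteq> 0" "lead_coeff ?u = 1" "ieval ?u z = 0"
  proof -
    show "has_simple_roots ?u" by (rule has_simple_roots_unity[OF z(2)])
    then show "?u \<noteq> 0" by (auto simp: has_simple_roots_def)
    show "ieval ?u z = 0" using z by (simp add: map_poly_of_int_hom poly_monom)
    have "degree ?u = n" using z(2) by (simp add: degree_monom_minus_1)
    then show "lead_coeff ?u = 1" using z(2) by simp
  qed
  obtain h where h: "prime_elem h" "degree h > 0" "ieval h z = 0"
    "\<And>f. ieval f z = 0 \<Longrightarrow> h dvd f"
    using minimal_int_poly[OF u(2,4)] by metis
  have hu: "h dvd ?u" and hf: "h dvd f" using h(4) u(4) z(3) by auto
  obtain s where s: "pcompose f (monom 1 p) - f ^ p = of_nat p * s"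
    using prime_dvd_pcompose_monom_diff_power[OF p(1), of f] by blast
  have ev: "of_nat p * ieval s x = ieval f (x ^ p)" if "ieval h x = 0" for x
  proof -
    have "ieval f x = 0" using ieval_dvd[OF hf that] .
    then have "ieval (pcompose f (monom 1 p) - f ^ p) x = ieval f (x ^ p)"
      using p(1) by (simp add: map_poly_of_int_hom map_poly_of_int_pcompose poly_pcompose poly_monom
          prime_gt_0_nat)
    then show ?thesis unfolding s by (simp add: map_poly_of_int_hom of_nat_poly map_poly_pCons)
  qed
  have "h dvd s"
  proof (rule kronecker_dvd_strict[OF h(1) _ _ h(2)])
    show "\<bar>lead_coeff h\<bar> = 1" using abs_lead_coeff_dvd[OF hu] u(3) by simp
    show "has_simple_roots h" using has_simple_roots_dvd[OF u(1) hu] .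
  next
    fix x assume x: "ieval h x = 0"
    have "x ^ n = 1" using ieval_dvd[OF hu x] by (simp add: map_poly_of_int_hom poly_monom)
    then have "cmod x = 1" using z(2) using power_eq_imp_eq_norm[of x n 1] by simp
    then have "cmod (ieval f (x ^ p)) \<le> real L" by (intro L) (simp add: norm_power)
    then have "real p * cmod (ieval s x) \<le> real L"
      using arg_cong[OF ev[OF x], of cmod] by (simp add: norm_mult)
    also have "real L < real p * 1" using p(2) by simp
    finally show "cmod (ieval s x) < 1" using p(2) by (simp add: mult_less_cancel_left)
  qed
  then have "ieval s z = 0" using ieval_dvd h(3) by blast
  with ev[OF h(3)] show ?thesis by simp
qed

text \<open>An exponent coprime to \<^term>\<open>n\<close> may be changed modulo \<^term>\<open>n\<close> so that all its prime
  factors are large; for a large prime \<^term>\<open>p\<close> the values of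
  \<open>(f(X^p) - f(X)^p) / p\<close> at the conjugates of \<^term>\<open>z\<close> are less than 1 in modulus.\<close>
proposition unity_root_conj:
  assumes z: "z ^ n = 1" "n > 0" "ieval f z = 0" and e: "coprime e n"
  shows "ieval f (z ^ e) = 0"
proof -
  obtain L where L: "\<And>x. cmod x = 1 \<Longrightarrow> cmod (ieval f x) \<le> real L"
    using ieval_bounded_unit_circle[of f] by blast
  \<comment> \<open>Prime factors of \<open>k\<close> are stripped one at a time;
    \<open>x ^ p\<close> is again an n-th root of unity and a root of \<open>f\<close>, so the same
    bound \<open>L\<close> keeps serving.\<close>
  have big: "ieval f (x ^ k) = 0"
    if "x ^ n = 1" "ieval f x = 0" "k > 0" "\<And>p. prime p \<Longrightarrow> p dvd k \<Longrightarrow> p > L" for x k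
    using that
  proof (induction k arbitrary: x rule: less_induct)
    case (less k)
    show ?case
    proof (cases "k = 1")
      case False
      then obtain p where p: "prime p" "p dvd k" using prime_factor_nat by blast
      then obtain j where j: "k = p * j" by auto
      have "ieval f (x ^ p) = 0"
        using less.prems p by (intro unity_root_prime_conj[OF _ z(2) _ L]) auto
      moreover have "(x ^ p) ^ n = 1"
        using less.prems(1) by (metis mult.commute power_mult power_one)
      moreover have "j < k" "j > 0" using less.prems(3) j prime_gt_1_nat[OF p(1)] by auto
      ultimately have "ieval f ((x ^ p) ^ j) = 0"
        proof -
        assume *: "ieval f (x ^ p) = 0" "(x ^ p) ^ n = 1" "j < k" "j > 0"
        show ?thesis using less.prems(4) j by (intro less.IH[OF *(3,2,1,4)]) simp
      qed
      then show ?thesis by (simp add: j power_mult)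
    qed (use less.prems in simp)
  qed
  \<comment> \<open>\<open>Q\<close> collects the small primes not dividing \<open>e\<close>. A
    small prime dividing \<open>e\<close> divides neither \<open>n\<close> nor \<open>Q\<close>, and
    one not dividing \<open>e\<close> divides \<open>Q\<close>; hence none divides
    \<open>e + n * Q\<close>.\<close>
  define Q where "Q = \<Prod>{p. prime p \<and> p \<le> L \<and> \<not> p dvd e}"
  have fin: "finite {p. prime p \<and> p \<le> L \<and> \<not> p dvd e}"
    by (rule finite_subset[of _ "{..L}"]) auto
  have Q: "Q > 0" unfolding Q_def by (intro prod_pos) (auto simp: prime_gt_0_nat)
  have large: "p > L" if p: "prime p" "p dvd e + n * Q" for p
  proof (rule ccontr)
    assume "\<not> p > L"
    show False
    proof (cases "p dvd e")
      case True
      then have "p dvd n * Q" using p(2) by (simp add: dvd_add_right_iff)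
      moreover have "\<not> p dvd n" using True e p(1)
        by (metis coprime_common_divisor not_prime_unit)
      ultimately have "p dvd Q" using p(1) prime_dvd_mult_nat by blast
      then obtain q where "prime q" "\<not> q dvd e" "p dvd q"
        using p(1) fin by (auto simp: Q_def prime_dvd_prod_iff)
      then show False using p(1) True primes_dvd_imp_eq by blast
    next
      case False
      then have "p dvd Q" unfolding Q_def using \<open>\<not> p > L\<close> p(1) fin by (intro dvd_prodI) auto
      then have "p dvd n * Q" by simp
      with False p(2) show False by (simp add: dvd_add_left_iff)
    qed
  qed
  have "ieval f (z ^ (e + n * Q)) = 0" using z Q by (intro big large) auto
  moreover have "z ^ (e + n * Q) = z ^ e" by (simp add: power_add power_mult z(1))
  ultimately show ?thesis by simp
qed

section \<open>Roots of the denominator polynomial\<close>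

lemma cis_double_minus: "cis (2 * a) - cis (2 * b) = cis (a + b) * (2 * \<i> * sin (a - b))"
proof -
  have "cis x - cis (- x) = 2 * \<i> * sin x" for x
    by (simp add: complex_eq_iff)
  from this[of "a - b"] have "cis (a + b) * (2 * \<i> * sin (a - b)) = cis (a + b) * (cis (a - b) - cis (- (a - b)))"
    by simp
  also have "\<dots> = cis (2 * a) - cis (2 * b)" by (simp add: right_diff_distrib cis_mult)
  finally show ?thesis by simp
qed

lemma cis_double_plus: "cis (2 * a) + 1 = cis a * (2 * cos a)"
proof -
  have "cis a + cis (- a) = 2 * cos a" by (simp add: complex_eq_iff)
  then have "cis a * (2 * cos a) = cis a * (cis a + cis (- a))" by simp
  also have "\<dots> = cis (2 * a) + 1" by (simp add: distrib_left cis_mult)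
  finally show ?thesis by simp
qed

lemma inj_on_cis_double: "inj_on (\<lambda>a. cis (2 * a)) {0<..<pi}"
proof (rule linorder_inj_onI)
  fix a b :: real
  assume ab: "a < b" "a \<in> {0<..<pi}" "b \<in> {0<..<pi}"
  have "sin (b - a) > 0" using ab by (intro sin_gt_zero) auto
  then show "cis (2 * a) \<noteq> cis (2 * b)"
    using cis_double_minus[of b a] by auto
qed auto

text \<open>The intermediate value theorem gives a zero between the nodes of index \<open>j\<close>
  and \<open>j + 1\<close> for \<open>0 < j < d - 1\<close>. These open intervals are disjoint, so
  the \<open>d - 2\<close> zeros are distinct.\<close>

lemma alternating_zeros:
  fixes f :: "real \<Rightarrow> real"
  assumes cont: "continuous_on UNIV f"
    and alt: "\<And>j. 0 < j \<Longrightarrow> j < d \<Longrightarrow> (- 1) ^ j * f (real j * pi / real d) < 0"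
  obtains A where "A \<subseteq> {0<..<pi}" "card A = d - 2" "\<And>x. x \<in> A \<Longrightarrow> f x = 0"
proof -
  define p where "p j = real j * pi / real d" for j
  have "\<exists>x. p j < x \<and> x < p (Suc j) \<and> f x = 0" if j: "0 < j" "Suc j < d" for j
  proof -
    define g where "g x = (- 1) ^ j * f x" for x
    have g: "g (p j) < 0" "0 < g (p (Suc j))"
      using alt[of j] alt[of "Suc j"] j by (simp_all add: g_def p_def)
    have le: "p j \<le> p (Suc j)" by (simp add: p_def divide_right_mono)
    have "continuous_on {p j..p (Suc j)} g"
      unfolding g_def by (intro continuous_intros continuous_on_subset[OF cont]) auto
    then obtain x where x: "p j \<le> x" "x \<le> p (Suc j)" "g x = 0"
      using IVT'[of g "p j" 0 "p (Suc j)"] g le by auto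
    then have "x \<noteq> p j" "x \<noteq> p (Suc j)" using g by auto
    with x show ?thesis by (intro exI[of _ x]) (auto simp: g_def)
  qed
  then obtain x where x: "\<And>j. 0 < j \<Longrightarrow> Suc j < d \<Longrightarrow> p j < x j \<and> x j < p (Suc j) \<and> f (x j) = 0"
    by metis
  have p_mono: "p i \<le> p j" if "i \<le> j" for i j
    using that by (simp add: p_def divide_right_mono)
  let ?J = "{1..<d - 1}"
  have "inj_on x ?J"
  proof (rule linorder_inj_onI)
    fix i j assume ij: "i < j" "i \<in> ?J" "j \<in> ?J"
    have "x i < p (Suc i)" using x[of i] ij by auto
    also have "\<dots> \<le> p j" using ij by (intro p_mono) auto
    also have "\<dots> < x j" using x[of j] ij by auto
    finally show "x i \<noteq> x j" by simp
  qed auto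
  then have "card (x ` ?J) = d - 2" by (simp add: card_image)
  moreover have "x ` ?J \<subseteq> {0<..<pi}"
  proof safe
    fix j assume j: "j \<in> ?J"
    have "p d = pi" "p 0 = 0" using j by (auto simp: p_def)
    moreover have "p 0 \<le> p j" "p (Suc j) \<le> p d" using j by (auto intro!: p_mono)
    moreover have "p j < x j" "x j < p (Suc j)" using x[of j] j by auto
    ultimately show "x j \<in> {0<..<pi}" by simp
  qed
  moreover have "f y = 0" if "y \<in> x ` ?J" for y using that x by auto
  ultimately show ?thesis using that by blast
qed

section \<open>Coefficients and values of the denominators\<close>

lemma coeff_D_poly_even:
  assumes "w \<ge> 2"
  shows "coeff (D_poly l (2 * w)) i =
    (if i = 0 \<or> i = w then 1 else if i < w then - (int l - 2) else 0)"
  using assms by (auto simp: D_poly_def coeff_sum)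

lemma coeff_D_poly_odd:
  assumes "w \<ge> 1"
  shows "coeff (D_poly l (Suc (2 * w))) i =
    (if i = 0 \<or> i = 2 * w then 1 else if i = w then - (int l - 4)
     else if i < 2 * w then - (int l - 2) else 0)"
  using assms by (auto simp: D_poly_def coeff_sum)

lemma degree_D_poly_even: "w \<ge> 2 \<Longrightarrow> degree (D_poly l (2 * w)) = w"
  by (intro antisym degree_le le_degree) (auto simp: coeff_D_poly_even)

lemma degree_D_poly_odd: "w \<ge> 1 \<Longrightarrow> degree (D_poly l (Suc (2 * w))) = 2 * w"
  by (intro antisym degree_le le_degree) (auto simp: coeff_D_poly_odd)

lemma nat_ge_3_cases:
  fixes m :: nat
  assumes "m \<ge> 3"
  obtains (even) w where "m = 2 * w" "w \<ge> 2" | (odd) w where "m = Suc (2 * w)" "w \<ge> 1"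
proof (cases "even m")
  case True
  then obtain w where "m = 2 * w" by (elim evenE)
  with assms show ?thesis by (intro even) auto
next
  case False
  then obtain w where "m = 2 * w + 1" by (elim oddE)
  with assms show ?thesis by (intro odd) auto
qed

lemma D_poly_basic:
  assumes "m \<ge> 3"
  shows "lead_coeff (D_poly l m) = 1" "coeff (D_poly l m) 0 = 1" "degree (D_poly l m) \<ge> 2"
    "D_poly l m \<noteq> 0" "reciprocal_poly (D_poly l m)"
proof -
  show *: "lead_coeff (D_poly l m) = 1" "coeff (D_poly l m) 0 = 1" "degree (D_poly l m) \<ge> 2"
    using assms
    by (cases m rule: nat_ge_3_cases;
        auto simp: coeff_D_poly_even degree_D_poly_even coeff_D_poly_odd degree_D_poly_odd
         )+
  show "D_poly l m \<noteq> 0" using * by auto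
  show "reciprocal_poly (D_poly l m)"
    using assms
    by (cases m rule: nat_ge_3_cases)
      (auto simp: reciprocal_poly_def coeff_D_poly_even degree_D_poly_even coeff_D_poly_odd
        degree_D_poly_odd)
qed

lemma poly_D_even:
  fixes z :: "'a :: comm_ring_1"
  shows "poly (map_poly of_int (D_poly l (2 * w))) z =
    1 - (of_nat l - 2) * (\<Sum>i\<in>{1..<w}. z ^ i) + z ^ w"
proof -
  have "(\<Sum>i\<in>{1..<w}. of_int (- (int l - 2)) * z ^ i) = (\<Sum>i\<in>{1..<w}. - (of_nat l - 2) * z ^ i)"
    by simp
  also have "\<dots> = - ((of_nat l - 2) * (\<Sum>i\<in>{1..<w}. z ^ i))"
    by (simp only: mult_minus_left sum_negf sum_distrib_left)
  finally have *: "(\<Sum>i\<in>{1..<w}. of_int (- (int l - 2)) * z ^ i)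
      = - ((of_nat l - 2) * (\<Sum>i\<in>{1..<w}. z ^ i))" .
  show ?thesis
    using * by (simp add: D_poly_def map_poly_of_int_hom poly_sum poly_monom del: of_int_minus of_int_diff)
qed

lemma poly_D_odd:
  fixes z :: "'a :: comm_ring_1"
  assumes "w \<ge> 1"
  shows "poly (map_poly of_int (D_poly l (Suc (2 * w)))) z =
    1 - (of_nat l - 2) * (\<Sum>i\<in>{1..<2*w}. z ^ i) + 2 * z ^ w + z ^ (2 * w)"
proof -
  have "(\<Sum>i\<in>{1..<2*w}. of_int (if i = w then - (int l - 4) else - (int l - 2)) * z ^ i)
      = (\<Sum>i\<in>{1..<2*w}. - (of_nat l - 2) * z ^ i + (if i = w then 2 * z ^ w else 0))"
    by (intro sum.cong) (auto simp: algebra_simps)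
  also have "\<dots> = - ((of_nat l - 2) * (\<Sum>i\<in>{1..<2*w}. z ^ i)) + 2 * z ^ w"
    using assms by (simp add: sum.distrib sum_subtractf sum_negf sum_distrib_left del: minus_diff_eq)
  finally show ?thesis
    by (simp add: D_poly_def map_poly_of_int_hom poly_sum poly_monom del: of_int_minus of_int_diff)
qed

lemma geometric_sum_from_1:
  fixes z :: "'a :: comm_ring_1"
  assumes "n \<ge> 1"
  shows "(z - 1) * (\<Sum>i\<in>{1..<n}. z ^ i) = z ^ n - z"
  using assms by (induction n rule: dec_induct) (simp_all add: algebra_simps)

lemma D_even_identity:
  fixes z :: "'a :: comm_ring_1"
  assumes "w \<ge> 1"
  shows "(z - 1) * poly (map_poly of_int (D_poly l (2 * w))) z =
    (z - 1) * (z ^ w + 1) - (of_nat l - 2) * (z ^ w - z)"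
proof -
  have "(z - 1) * poly (map_poly of_int (D_poly l (2 * w))) z =
      (z - 1) * (z ^ w + 1) - (of_nat l - 2) * ((z - 1) * (\<Sum>i\<in>{1..<w}. z ^ i))"
    unfolding poly_D_even by (simp add: algebra_simps)
  then show ?thesis by (simp only: geometric_sum_from_1[OF assms])
qed

text \<open>The middle coefficient exceeds \<open>- (l - 2)\<close> by 2, and the resulting
  \<open>2 * z ^ w\<close> completes the square of \<open>z ^ w + 1\<close>.\<close>

lemma D_odd_identity:
  fixes z :: "'a :: comm_ring_1"
  assumes "w \<ge> 1"
  shows "(z - 1) * poly (map_poly of_int (D_poly l (Suc (2 * w)))) z =
    (z - 1) * (z ^ w + 1) ^ 2 - (of_nat l - 2) * (z ^ (2 * w) - z)"
proof -
  have "(z - 1) * poly (map_poly of_int (D_poly l (Suc (2 * w)))) z =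
      (z - 1) * (1 + 2 * z ^ w + z ^ (2 * w))
      - (of_nat l - 2) * ((z - 1) * (\<Sum>i\<in>{1..<2*w}. z ^ i))"
    unfolding poly_D_odd[OF assms] by (simp add: algebra_simps)
  also have "(z - 1) * (\<Sum>i\<in>{1..<2*w}. z ^ i) = z ^ (2 * w) - z"
    using assms by (intro geometric_sum_from_1) simp
  also have "1 + 2 * z ^ w + z ^ (2 * w) = (z ^ w + 1) ^ 2"
    by (simp add: power2_eq_square algebra_simps flip: power_add mult_2)
  finally show ?thesis .
qed

text \<open>The value is \<open>2 - (l - 2) * (w - 1)\<close> or
  \<open>4 - (l - 2) * (2 * w - 1)\<close>, whose negativity is exactly the hyperbolicity
  condition.\<close>

lemma D_poly_at_1_neg:
  assumes "m \<ge> 3" "(int l - 2) * (int m - 2) > 4"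
  shows "poly (map_poly of_int (D_poly l m)) (1 :: real) < 0"
proof -
  have ineq: "(real l - 2) * (real m - 2) > 4"
  proof -
    have "real_of_int ((int l - 2) * (int m - 2)) > 4" using assms(2) by linarith
    then show ?thesis by simp
  qed
  show ?thesis using assms(1)
  proof (cases m rule: nat_ge_3_cases)
    case (even w)
    then have "poly (map_poly of_int (D_poly l m)) (1 :: real) = 2 - (real l - 2) * (real w - 1)"
      unfolding even(1) poly_D_even by (simp add: of_nat_diff)
    with ineq even show ?thesis by (simp add: algebra_simps)
  next
    case (odd w)
    then have "poly (map_poly of_int (D_poly l m)) (1 :: real) = 4 - (real l - 2) * (2 * real w - 1)"
      unfolding odd(1) poly_D_odd[OF odd(2)] by (simp add: of_nat_diff)
    with ineq odd show ?thesis by (simp add: algebra_simps)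
  qed
qed

text \<open>At \<open>z = cis (2 * x)\<close> the half-angle formulas extract a common phase from
  the root equation, leaving a real function of \<open>x\<close> between 0 and pi, where
  \<open>z - 1\<close> does not vanish.\<close>

lemma D_poly_circle_roots:
  assumes l: "l \<ge> 3" and m: "m \<ge> 3"
  obtains R where "card R = degree (D_poly l m) - 2" "finite R"
    "\<And>z. z \<in> R \<Longrightarrow> cmod z = 1 \<and> ieval (D_poly l m) z = 0"
proof -
  define q where "q = real l - 2"
  have q: "q \<ge> 1" "complex_of_real q = of_nat l - 2" using l by (simp_all add: q_def)
  have "\<exists>f :: real \<Rightarrow> real. continuous_on UNIV f \<and>
      (\<forall>j>0. j < degree (D_poly l m) \<longrightarrow> (- 1) ^ j * f (real j * pi / real (degree (D_poly l m))) < 0) \<and>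
      (\<forall>x\<in>{0<..<pi}. f x = 0 \<longrightarrow> (cis (2 * x) - 1) * ieval (D_poly l m) (cis (2 * x)) = 0)"
    using m
  proof (cases m rule: nat_ge_3_cases)
    case (even w)
    define f where "f x = q * sin (real w * x - x) - 2 * sin x * cos (real w * x)" for x
    have deg: "degree (D_poly l m) = w" using even by (simp add: degree_D_poly_even)
    have "continuous_on UNIV f" unfolding f_def by (intro continuous_intros)
    moreover have "(- 1) ^ j * f (real j * pi / real w) < 0" if j: "0 < j" "j < w" for j
    proof -
      define x where "x = real j * pi / real w"
      have wx: "real w * x = real j * pi" using j by (simp add: x_def)
      have "x > 0" "x < pi" using j by (auto simp: x_def field_simps)
      then have sx: "sin x > 0" by (rule sin_gt_zero)
      \<comment> \<open>At a node \<open>sin (real w * x)\<close> vanishes and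
        \<open>cos (real w * x)\<close> is the alternating sign, so both terms of \<open>f\<close>
        agree in sign.\<close>
      have "f x = - ((- 1) ^ j * (q + 2) * sin x)"
        unfolding f_def wx by (simp add: sin_diff algebra_simps)
      then have "(- 1) ^ j * f x = - (((- 1) ^ j * (- 1) ^ j) * ((q + 2) * sin x))"
        by (simp add: mult_ac)
      also have "(- 1) ^ j * (- 1) ^ j = (1 :: real)" by (simp flip: power_mult_distrib)
      finally show ?thesis using sx q(1) by (simp add: x_def)
    qed
    moreover have "(cis (2 * x) - 1) * ieval (D_poly l m) (cis (2 * x)) = 0" if "f x = 0" for x
    proof -
      let ?z = "cis (2 * x)"
      have t: "?z ^ w = cis (2 * (real w * x))" by (simp add: Complex.DeMoivre mult_ac)
      have 1: "?z - 1 = cis x * (2 * \<i> * sin x)" using cis_double_minus[of x 0] by simp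
      have 2: "?z ^ w + 1 = cis (real w * x) * (2 * cos (real w * x))"
        unfolding t by (rule cis_double_plus)
      have 3: "?z ^ w - ?z = cis (real w * x + x) * (2 * \<i> * sin (real w * x - x))"
        unfolding t by (rule cis_double_minus)
      have "(?z - 1) * ieval (D_poly l m) ?z =
          (?z - 1) * (?z ^ w + 1) - of_real q * (?z ^ w - ?z)"
        using D_even_identity[of w ?z l] even by (simp add: q(2))
      also have "\<dots> = - 2 * \<i> * cis (real w * x + x) * of_real (f x)"
        unfolding 1 2 3 f_def by (simp add: algebra_simps flip: cis_mult)
      finally show ?thesis using that by simp
    qed
    ultimately show ?thesis unfolding deg by blast
  next
    case (odd w)
    define f where "f x = q * sin (real (2 * w) * x - x) - 4 * sin x * cos (real w * x) ^ 2" for x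
    have deg: "degree (D_poly l m) = 2 * w" using odd by (simp add: degree_D_poly_odd)
    have "continuous_on UNIV f" unfolding f_def by (intro continuous_intros)
    moreover have "(- 1) ^ j * f (real j * pi / real (2 * w)) < 0" if j: "0 < j" "j < 2 * w" for j
    proof -
      define x where "x = real j * pi / real (2 * w)"
      have wx: "real (2 * w) * x = real j * pi" using j by (simp add: x_def)
      have "x > 0" "x < pi" using j by (auto simp: x_def field_simps)
      then have sx: "sin x > 0" by (rule sin_gt_zero)
      \<comment> \<open>Here \<open>real w * x\<close> may be a half-integer multiple of pi, so the
        squared cosine is evaluated by doubling the angle.\<close>
      have "2 * cos (real w * x) ^ 2 = 1 + cos (2 * (real w * x))"
        by (simp add: cos_double_cos)
      also have "2 * (real w * x) = real j * pi" using wx by simp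
      finally have c: "4 * sin x * cos (real w * x) ^ 2 = 2 * sin x * (1 + (- 1) ^ j)"
        by simp
      have fx: "f x = - ((- 1) ^ j * q * sin x) - 2 * sin x * (1 + (- 1) ^ j)"
        unfolding f_def wx c by (simp add: sin_diff algebra_simps)
      have "(- 1) ^ j * f x = - (((- 1) ^ j * (- 1) ^ j) * (q * sin x))
          - 2 * sin x * ((- 1) ^ j + (- 1) ^ j * (- 1) ^ j)"
        unfolding fx by algebra
      also have "(- 1) ^ j * (- 1) ^ j = (1 :: real)" by (simp flip: power_mult_distrib)
      also have "- (1 * (q * sin x)) - 2 * sin x * ((- 1) ^ j + 1) = - (q + 2 * (1 + (- 1) ^ j)) * sin x"
        by (simp add: algebra_simps)
      also have "\<dots> < 0"
      proof -
        \<comment> \<open>The sum is \<open>q + 4\<close> or \<open>q\<close> according to the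
          parity of \<open>j\<close>.\<close>
        have "q + 2 * (1 + (- 1) ^ j) > 0" using q(1) by (cases "even j") simp_all
        then show ?thesis using sx by (simp add: mult_neg_pos)
      qed
      finally show ?thesis by (simp add: x_def)
    qed
    moreover have "(cis (2 * x) - 1) * ieval (D_poly l m) (cis (2 * x)) = 0" if "f x = 0" for x
    proof -
      let ?z = "cis (2 * x)"
      have t: "?z ^ w = cis (2 * (real w * x))" by (simp add: Complex.DeMoivre mult_ac)
      have t': "?z ^ (2 * w) = cis (2 * (real (2 * w) * x))" by (simp add: Complex.DeMoivre mult_ac)
      have 1: "?z - 1 = cis x * (2 * \<i> * sin x)" using cis_double_minus[of x 0] by simp
      have 2: "?z ^ w + 1 = cis (real w * x) * (2 * cos (real w * x))"
        unfolding t by (rule cis_double_plus)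
      have 3: "?z ^ (2 * w) - ?z = cis (real (2 * w) * x + x) * (2 * \<i> * sin (real (2 * w) * x - x))"
        unfolding t' by (rule cis_double_minus)
      have 4: "cis (real (2 * w) * x + x) = cis (real w * x) ^ 2 * cis x"
        by (simp add: Complex.DeMoivre cis_mult mult.assoc)
      have "(?z - 1) * ieval (D_poly l m) ?z =
          (?z - 1) * (?z ^ w + 1) ^ 2 - of_real q * (?z ^ (2 * w) - ?z)"
        using D_odd_identity[of w ?z l] odd by (simp add: q(2))
      also have "\<dots> = - 2 * \<i> * cis (real (2 * w) * x + x) * of_real (f x)"
        unfolding 1 2 3 f_def 4 by (simp add: algebra_simps power2_eq_square)
      finally show ?thesis using that by simp
    qed
    ultimately show ?thesis unfolding deg by blast
  qed
  then obtain f :: "real \<Rightarrow> real" where f: "continuous_on UNIV f"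
      "\<And>j. 0 < j \<Longrightarrow> j < degree (D_poly l m) \<Longrightarrow>
        (- 1) ^ j * f (real j * pi / real (degree (D_poly l m))) < 0"
      "\<And>x. x \<in> {0<..<pi} \<Longrightarrow> f x = 0 \<Longrightarrow> (cis (2 * x) - 1) * ieval (D_poly l m) (cis (2 * x)) = 0"
    by blast
  from alternating_zeros[OF f(1,2)] obtain A where A: "A \<subseteq> {0<..<pi}"
      "card A = degree (D_poly l m) - 2" "\<And>x. x \<in> A \<Longrightarrow> f x = 0" by blast
  define R where "R = (\<lambda>a. cis (2 * a)) ` A"
  have cR: "card R = degree (D_poly l m) - 2"
    unfolding R_def A(2)[symmetric] by (intro card_image inj_on_subset[OF inj_on_cis_double A(1)])
  have R: "cmod z = 1 \<and> ieval (D_poly l m) z = 0" if z: "z \<in> R" for z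
  proof -
    from z obtain x where x: "x \<in> A" "z = cis (2 * x)" by (auto simp: R_def)
    have "sin x > 0" using A(1) x(1) by (intro sin_gt_zero) auto
    then have "z - 1 \<noteq> 0" using cis_double_minus[of x 0] by (simp add: x(2))
    then show ?thesis using f(3)[of x] A(1,3) x by auto
  qed
  have "finite R"
    by (rule finite_subset[OF _ finite_ieval_roots[OF D_poly_basic(4)[OF m]]]) (use R in blast)
  from that[OF cR this R] show ?thesis .
qed

section \<open>Reciprocal pairs of roots and the Salem property\<close>

lemma reciprocal_poly_root:
  fixes x :: real
  assumes f: "reciprocal_poly f" "poly (map_poly of_int f) x = 0" "x \<noteq> 0"
  shows "poly (map_poly of_int f) (inverse x) = 0"
proof -
  let ?f = "map_poly of_int f :: real poly"
  have "reflect_poly ?f = ?f"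
  proof (rule poly_eqI)
    fix n
    have "coeff f (degree f - n) = coeff f n" if "n \<le> degree f"
      using f(1) that by (metis reciprocal_poly_def)
    then show "coeff (reflect_poly ?f) n = coeff ?f n"
      by (cases "n \<le> degree f") (simp_all add: coeff_reflect_poly coeff_map_poly coeff_eq_0)
  qed
  then show ?thesis using poly_reflect_poly_nz[OF f(3), of ?f] f(2,3) by simp
qed

text \<open>\<open>x\<close>, its inverse and the roots found on the circle are distinct, and their
  number reaches the degree; so there are no others and all are simple.\<close>

lemma D_poly_roots:
  assumes l: "l \<ge> 3" and m: "m \<ge> 3" and lm: "(int l - 2) * (int m - 2) > 4"
  obtains x :: real where "x > 1" "has_simple_roots (D_poly l m)"
    "ieval (D_poly l m) (of_real x) = 0"
    "\<And>z. ieval (D_poly l m) z = 0 \<Longrightarrow> z = of_real x \<or> cmod z \<le> 1"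
proof -
  let ?D = "D_poly l m"
  let ?f = "map_poly of_int ?D :: real poly"
  note D = D_poly_basic[OF m, of l]
  have lc: "lead_coeff ?f = 1" using D(1) by (simp add: coeff_map_poly)
  then obtain b where b: "\<And>x. x \<ge> b \<Longrightarrow> poly ?f x \<ge> 1"
    using poly_pinfty_gt_lc[of ?f] by auto
  have "poly ?f (max b 2) > 0" using b[of "max b 2"] by simp
  then obtain x where x: "x > 1" "poly ?f x = 0"
    using poly_IVT_pos[of 1 "max b 2" ?f] D_poly_at_1_neg[OF m lm] by fastforce
  have x': "poly ?f (inverse x) = 0"
    using x D by (intro reciprocal_poly_root) auto
  have of_real: "ieval ?D (of_real y) = of_real (poly ?f y)" for y
    by (simp add: poly_altdef coeff_map_poly)
  from D_poly_circle_roots[OF l m] obtain R where R: "card R = degree ?D - 2" "finite R"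
    "\<And>z. z \<in> R \<Longrightarrow> cmod z = 1 \<and> ieval ?D z = 0" by blast
  define S where "S = insert (of_real x) (insert (of_real (inverse x)) R)"
  have ix: "0 < inverse x" "inverse x < 1" using x(1) by (simp_all add: field_simps)
  have "of_real x \<notin> insert (of_real (inverse x)) R" "of_real (inverse x) \<notin> R"
    using R(3)[of "of_real x"] R(3)[of "of_real (inverse x)"] x(1) ix
    by (auto simp del: of_real_inverse)
  then have cS: "card S = degree ?D"
    using R(1,2) D(3) by (simp add: S_def)
  have sub: "S \<subseteq> {z. ieval ?D z = 0}"
    using R(3) x(2) x' by (auto simp: S_def of_real simp del: of_real_inverse)
  moreover have "card {z. ieval ?D z = 0} \<le> degree ?D"
    using card_poly_roots_bound[of "map_poly of_int ?D :: complex poly"] D(4) by simp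
  ultimately have S: "S = {z. ieval ?D z = 0}"
    using cS by (intro card_seteq finite_ieval_roots D(4)) auto
  show ?thesis
  proof (rule that[OF x(1)])
    show "has_simple_roots ?D" using S cS D(4) by (simp add: has_simple_roots_def)
    show "ieval ?D (of_real x) = 0" using x(2) by (simp add: of_real)
    fix z assume "ieval ?D z = 0"
    then have "z \<in> S" using S by simp
    then show "z = of_real x \<or> cmod z \<le> 1"
      using R(3)[of z] ix by (auto simp: S_def simp del: of_real_inverse)
  qed
qed

text \<open>For a multiple root \<open>z\<close>, removing one factor \<open>X - z\<close> would
  keep the set of roots while lowering the degree.\<close>

lemma has_simple_roots_order:
  assumes "has_simple_roots f" "ieval f z = 0"
  shows "order z (map_poly of_int f) = 1"
proof (rule ccontr)
  let ?f = "map_poly of_int f :: complex poly"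
  have nz: "?f \<noteq> 0" using assms(1) by (simp add: has_simple_roots_def)
  assume "order z ?f \<noteq> 1"
  moreover have "order z ?f \<noteq> 0" using assms(2) nz by (simp add: order_root)
  ultimately have "order z ?f \<ge> 2" by simp
  then have "[:- z, 1:] ^ 2 dvd ?f" using order_1 power_le_dvd by blast
  then obtain g where "?f = [:- z, 1:] ^ 2 * g" by (rule dvdE)
  then have g: "?f = [:- z, 1:] * ([:- z, 1:] * g)" by (simp only: power2_eq_square mult.assoc)
  define h where "h = [:- z, 1:] * g"
  have fh: "?f = [:- z, 1:] * h" using g h_def by simp
  have h: "h \<noteq> 0" "poly h z = 0" using nz by (auto simp: fh h_def)
  have "{x. ieval f x = 0} = {x. poly h x = 0}" unfolding fh using h(2) by auto
  then have "degree f \<le> degree h"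
    using card_poly_roots_bound[OF h(1)] assms(1) by (simp add: has_simple_roots_def)
  moreover have "degree f = Suc (degree h)"
    using arg_cong[OF fh, of degree] h(1) by (simp add: degree_mult_eq del: mult_pCons_left)
  ultimately show False by simp
qed

lemma salem_D_poly:
  assumes "l \<ge> 3" "m \<ge> 3" "(int l - 2) * (int m - 2) > 4"
  shows "salem_poly (D_poly l m)"
proof -
  from D_poly_roots[OF assms] obtain x :: real where x: "x > 1" "has_simple_roots (D_poly l m)"
    "ieval (D_poly l m) (of_real x) = 0"
    "\<And>z. ieval (D_poly l m) z = 0 \<Longrightarrow> z = of_real x \<or> cmod z \<le> 1" by blast
  have "\<exists>!z. ieval (D_poly l m) z = 0 \<and> cmod z > 1"
  proof (rule ex1I[of _ "of_real x"])
    show "ieval (D_poly l m) (of_real x) = 0 \<and> cmod (of_real x) > 1" using x by simp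
  next
    fix z assume "ieval (D_poly l m) z = 0 \<and> cmod z > 1"
    then show "z = of_real x" using x(4)[of z] by auto
  qed
  moreover have "order z (map_poly of_int (D_poly l m)) = 1"
    if "ieval (D_poly l m) z = 0" for z using has_simple_roots_order[OF x(2) that] .
  ultimately show ?thesis using D_poly_basic(1)[OF assms(2)] by (simp add: salem_poly_def)
qed

section \<open>Elimination\<close>

text \<open>The relation \<open>t + 1 / t = 2 * Re t\<close>, cleared of denominators so that it can
  enter polynomial elimination.\<close>

lemma unit_circle_quadratic:
  assumes "cmod t = 1"
  shows "t ^ 2 + 1 = t * of_real (2 * Re t)"
proof -
  have "t * of_real (2 * Re t) = t * (t + cnj t)" by (simp add: complex_add_cnj)
  also have "\<dots> = t ^ 2 + t * cnj t" by (simp add: power2_eq_square algebra_simps)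
  also have "t * cnj t = 1" using assms by (simp add: complex_norm_square[symmetric])
  finally show ?thesis by simp
qed

text \<open>\<open>t\<close> stands for \<open>z ^ w\<close>, so the second equation is the root
  equation at \<open>z ^ 2\<close>. As \<open>t ^ 2 - z ^ 2\<close> contains the factor
  \<open>t - z\<close>, the first equation removes \<open>q\<close> without division.\<close>

lemma even_elim_square:
  fixes z t q :: complex
  assumes "(z - 1) * (t + 1) = q * (t - z)" "(z ^ 2 - 1) * (t ^ 2 + 1) = q * (t ^ 2 - z ^ 2)"
  shows "(z - 1) * ((1 - t) * (z * t - 1)) = 0"
  using assms by algebra

text \<open>The conjugate is \<open>- z\<close> with \<open>w\<close> odd, so \<open>t\<close>
  becomes \<open>- t\<close>; adding the equations cancels \<open>q\<close>.\<close>

lemma even_elim_minus: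
  fixes z t q :: complex
  assumes "(z - 1) * (t + 1) = q * (t - z)" "(- z - 1) * (- t + 1) = q * (- t + z)"
  shows "z * t = 1"
  using assms by algebra

text \<open>The conjugate is \<open>- (z ^ 2)\<close> with \<open>w\<close> odd; the right-hand side
  again contains \<open>t - z\<close>.\<close>

lemma even_elim_minus_square:
  fixes z t q :: complex
  assumes "(z - 1) * (t + 1) = q * (t - z)" "(- (z ^ 2) - 1) * (- (t ^ 2) + 1) = q * (- (t ^ 2) + z ^ 2)"
  shows "(t + 1) * ((z + 1) * (z * t - 1)) = 0"
  using assms by algebra

text \<open>The conjugate is \<open>- (z ^ 2)\<close> with \<open>w\<close> even. The equations read
  \<open>z * t - 1 = (q + 1) * (t - z)\<close> and
  \<open>(z * t) ^ 2 + 1 = - (q + 1) * (z ^ 2 + t ^ 2)\<close>; eliminating \<open>t - z\<close>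
  leaves a quadratic in \<open>z * t\<close>.\<close>

lemma even_elim_minus_square':
  fixes z t q :: complex
  assumes "(z - 1) * (t + 1) = q * (t - z)" "(- (z ^ 2) - 1) * (t ^ 2 + 1) = q * (t ^ 2 + z ^ 2)"
  shows "(q + 2) * ((z * t) ^ 2 + 2 * q * (z * t) + 1) = 0"
  using assms by algebra

text \<open>The factor \<open>t ^ 2 - z\<close> of \<open>t ^ 4 - z ^ 2\<close> removes
  \<open>q\<close>. The outcome is linear in \<open>z\<close>, which becomes a rational function of
  \<open>t\<close>.\<close>

lemma odd_elim_square:
  fixes z t q :: complex
  assumes "(z - 1) * (t + 1) ^ 2 = q * (t ^ 2 - z)"
    "(z ^ 2 - 1) * (t ^ 2 + 1) ^ 2 = q * (t ^ 4 - z ^ 2)"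
  shows "(z - 1) * ((t - 1) * (z * (t * (t ^ 2 + t + 2)) - (2 * t ^ 2 + t + 1))) = 0"
  using assms by algebra

text \<open>Inserting that value of \<open>z\<close> gives, apart from \<open>t - 1\<close>, a
  palindromic polynomial in \<open>t\<close>, hence one in \<open>y = t + 1 / t\<close>. For real
  \<open>y\<close> and \<open>q >= 1\<close> it is a sum of nonnegative parts.\<close>

lemma odd_elim_square_real:
  fixes z t q y :: complex
  assumes "(z - 1) * (t + 1) ^ 2 = q * (t ^ 2 - z)"
    "z * (t * (t ^ 2 + t + 2)) = 2 * t ^ 2 + t + 1" "t ^ 2 + 1 = t * y"
  shows "(t - 1) * (t ^ 2 * ((q + 1) * (y + 1) ^ 2 + q - 1)) = 0"
proof -
  have "(t - 1) * ((t ^ 2 + 1) * (t + 1) ^ 2 + q * (t ^ 4 + 2 * t ^ 3 + 4 * t ^ 2 + 2 * t + 1)) = 0"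
    using assms(1,2) by algebra
  moreover have "(t ^ 2 + 1) * (t + 1) ^ 2 + q * (t ^ 4 + 2 * t ^ 3 + 4 * t ^ 2 + 2 * t + 1)
      = t ^ 2 * ((q + 1) * (y + 1) ^ 2 + q - 1)"
    using assms(3) by algebra
  ultimately show ?thesis by simp
qed

text \<open>The conjugate is \<open>- z\<close> with \<open>w\<close> odd. Eliminating
  \<open>z\<close> again leaves a palindromic polynomial in \<open>t\<close>; for real
  \<open>y\<close> and positive \<open>q\<close> its form bounds \<open>q\<close> by 2.\<close>

lemma odd_elim_minus:
  fixes z t q y :: complex
  assumes "(z - 1) * (t + 1) ^ 2 = q * (t ^ 2 - z)"
    "(- z - 1) * (- t + 1) ^ 2 = q * (t ^ 2 + z)" "t ^ 2 + 1 = t * y"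
  shows "t ^ 2 * ((q + 1) * y ^ 2 + q ^ 2 - 4) = 0"
proof -
  have "(1 - t ^ 2) ^ 2 + q ^ 2 * t ^ 2 + q * (1 + t ^ 2) ^ 2 = 0"
    using assms(1,2) by algebra
  moreover have "(1 - t ^ 2) ^ 2 + q ^ 2 * t ^ 2 + q * (1 + t ^ 2) ^ 2 = t ^ 2 * ((q + 1) * y ^ 2 + q ^ 2 - 4)"
    using assms(3) by algebra
  ultimately show ?thesis by simp
qed

text \<open>With \<^term>\<open>y = t + 1 / t\<close>, \<open>P = q t + y + 2\<close> and \<open>P' = q / t + y + 2\<close>, these are
  \<open>P^2 + P'^2\<close> and \<open>P^2 / t^2 + t^2 P'^2\<close>; the equation for \<^term>\<open>z\<close> reads \<open>z P' = P\<close>.\<close>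
definition sym_form :: "'a::comm_ring_1 \<Rightarrow> 'a \<Rightarrow> 'a" where
  "sym_form q y = q ^ 2 * (y ^ 2 - 2) + 2 * q * (y + 2) * y + 2 * (y + 2) ^ 2"

definition twisted_form :: "'a::comm_ring_1 \<Rightarrow> 'a \<Rightarrow> 'a" where
  "twisted_form q y = 2 * q ^ 2 + 2 * q * (y + 2) * y + (y + 2) ^ 2 * (y ^ 2 - 2)"

text \<open>\<open>s\<close> stands for \<open>(- (z ^ 2)) ^ w + 1\<close>. Multiplying the
  conjugate equation by \<open>P' ^ 2\<close> and replacing \<open>z * P'\<close> by
  \<open>t * P\<close> eliminates \<open>z\<close>.\<close>

lemma odd_elim_minus_square:
  fixes z t q y s e :: complex
  assumes G: "(z - 1) * (t + 1) ^ 2 = q * (t ^ 2 - z)"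
    and B: "(- (z ^ 2) - 1) * s ^ 2 = q * (t ^ 4 + z ^ 2)"
    and y: "t ^ 2 + 1 = t * y" and s: "s ^ 2 = t ^ 2 * e"
  shows "t ^ 4 * (e * sym_form q y + q * twisted_form q y) = 0"
proof -
  \<comment> \<open>This \<open>P'\<close> is \<open>t\<close> times \<open>q / t + y + 2\<close>,
    to avoid a denominator.\<close>
  define P P' where "P = q * t + (y + 2)" and "P' = q + (y + 2) * t"
  have zP: "z * P' = t * P" unfolding P_def P'_def using G y by algebra
  have "(- ((z * P') ^ 2) - P' ^ 2) * s ^ 2 = q * (t ^ 4 * P' ^ 2 + (z * P') ^ 2)"
    using B by algebra
  then have *: "- ((t ^ 2 * P ^ 2 + P' ^ 2) * (t ^ 2 * e)) = q * (t ^ 4 * P' ^ 2 + t ^ 2 * P ^ 2)"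
    unfolding zP s by algebra
  have 1: "t ^ 2 * P ^ 2 + P' ^ 2 = t ^ 2 * sym_form q y"
    unfolding P_def P'_def sym_form_def using y by algebra
  have 2: "t ^ 4 * P' ^ 2 + t ^ 2 * P ^ 2 = t ^ 4 * twisted_form q y"
    unfolding P_def P'_def twisted_form_def using y by algebra
  show ?thesis using * unfolding 1 2 by algebra
qed

text \<open>The case \<open>e = y ^ 2\<close> of even \<open>w\<close>. The right-hand side is a sum
  of nonnegative terms for \<open>q >= 2\<close> and a difference of squares at
  \<open>q = 1\<close>.\<close>

lemma S_plus_identity:
  fixes q y :: real
  shows "(q + 2) * (y ^ 2 * sym_form q y + q * twisted_form q y) =
    (q + 1) * y ^ 2 * ((q + 2) * y + 4) ^ 2 + 2 * q * (q - 2) * (y + q + 2) ^ 2"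
  unfolding sym_form_def twisted_form_def by algebra

text \<open>The case \<open>e = y ^ 2 - 4\<close> of odd \<open>w\<close>, expanded in powers of
  \<open>q - 3\<close> with visibly nonnegative coefficients. For \<open>q >= 3\<close> a zero thus
  forces \<open>q = 3\<close> and \<open>y = 1\<close>.\<close>

lemma S_minus_identity:
  fixes q y :: real
  shows "(y ^ 2 - 4) * sym_form q y + q * twisted_form q y =
    2 * (q - 3) ^ 3 + (q - 3) ^ 2 * ((y ^ 2 - 3) ^ 2 + 2 * (y + 1) ^ 2 + 15)
    + (q - 3) * ((3 * y ^ 2 + 4 / 3 * y - 6) ^ 2 + 38 / 9 * (y + 36 / 19) ^ 2 + 814 / 19)
    + 2 * (y - 1) ^ 2 * (10 * (y + 9 / 5) ^ 2 + 13 / 5)"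
  unfolding sym_form_def twisted_form_def by (simp add: field_simps power2_eq_square power3_eq_cube)

text \<open>For \<open>q = 1\<close> the first equation has real solutions between -2 and 2, so the
  conjugation is applied twice: \<open>- (z ^ 2)\<close> has \<open>- (t ^ 2)\<close> in place of
  \<open>t\<close> for odd \<open>w\<close>, hence \<open>2 - y ^ 2\<close> in place of
  \<open>y\<close>. The two polynomials have no common root.\<close>

lemma S_minus_1:
  fixes y :: real
  assumes "(y ^ 2 - 4) * sym_form 1 y + 1 * twisted_form 1 y = 0"
    "((2 - y ^ 2) ^ 2 - 4) * sym_form 1 (2 - y ^ 2) + 1 * twisted_form 1 (2 - y ^ 2) = 0"
  shows False
proof -
  have "3 * y ^ 4 + 8 * y ^ 3 - 5 * y ^ 2 - 26 * y - 15 = 0"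
    using assms(1) unfolding sym_form_def twisted_form_def power_one mult_1 mult_1_right by algebra
  moreover have "3 * (2 - y ^ 2) ^ 4 + 8 * (2 - y ^ 2) ^ 3 - 5 * (2 - y ^ 2) ^ 2 - 26 * (2 - y ^ 2) - 15 = 0"
    using assms(2) unfolding sym_form_def twisted_form_def power_one mult_1 mult_1_right by algebra
  ultimately show False by algebra
qed

text \<open>At \<open>q = 2\<close> the polynomial has the factor \<open>y\<close>, so the same
  elimination is applied to the remaining cubics.\<close>

lemma S_minus_2:
  fixes y :: real
  assumes "(y ^ 2 - 4) * sym_form 2 y + 2 * twisted_form 2 y = 0"
    "((2 - y ^ 2) ^ 2 - 4) * sym_form 2 (2 - y ^ 2) + 2 * twisted_form 2 (2 - y ^ 2) = 0"
    "y \<noteq> 0" "2 - y ^ 2 \<noteq> 0"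
  shows False
proof -
  have *: "x * (3 * x ^ 3 + 6 * x ^ 2 - 7 * x - 16) = 0"
    if "(x ^ 2 - 4) * sym_form 2 x + 2 * twisted_form 2 x = 0" for x :: real
    using that unfolding sym_form_def twisted_form_def by algebra
  have "3 * y ^ 3 + 6 * y ^ 2 - 7 * y - 16 = 0" using *[OF assms(1)] assms(3) by simp
  moreover have "3 * (2 - y ^ 2) ^ 3 + 6 * (2 - y ^ 2) ^ 2 - 7 * (2 - y ^ 2) - 16 = 0"
    using *[OF assms(2)] assms(4) by simp
  ultimately show False by algebra
qed

section \<open>Roots of unity among the roots\<close>

lemma ieval_D_poly_1:
  assumes "m \<ge> 3" "(int l - 2) * (int m - 2) > 4"
  shows "ieval (D_poly l m) 1 \<noteq> 0"
proof -
  have "ieval (D_poly l m) (of_real 1) = of_real (poly (map_poly of_int (D_poly l m)) 1)"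
    by (simp add: poly_altdef coeff_map_poly)
  then show ?thesis using D_poly_at_1_neg[OF assms] by (simp only: of_real_1 of_real_eq_0_iff)
qed

text \<open>The alternatives say that the order is odd, twice odd, or divisible by 4, in the form
  that yields conjugates directly. Halving an even exponent gives either 1, and the argument
  repeats, or -1.\<close>

lemma unity_root_cases:
  fixes z :: complex
  assumes "z ^ n = 1" "n > 0"
  obtains N where "odd N" "z ^ N = 1" | r where "odd r" "z ^ r = - 1" | h where "even h" "z ^ h = - 1"
proof -
  have "(\<exists>N. odd N \<and> z ^ N = 1) \<or> (\<exists>h. z ^ h = - 1)"
    using assms
  proof (induction n rule: less_induct)
    case (less n)
    show ?case
    proof (cases "odd n")
      case False
      then obtain h where h: "n = 2 * h" by blast
      have "(z ^ h) ^ 2 = z ^ n" by (simp add: h mult.commute flip: power_mult)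
      then have "z ^ h = 1 \<or> z ^ h = - 1" using less.prems(1) by (simp add: power2_eq_1_iff)
      moreover have "h < n" "h > 0" using h less.prems(2) by auto
      ultimately show ?thesis using less.IH by blast
    qed (use less.prems in blast)
  qed
  then show ?thesis using that by blast
qed

lemma unity_root_conj_square:
  assumes "z ^ N = 1" "odd N" "ieval f z = 0"
  shows "ieval f (z ^ 2) = 0"
  using assms by (intro unity_root_conj[of z N]) (auto simp: odd_pos)

text \<open>The exponent \<open>r + 2\<close> is coprime to \<open>2 * r\<close> for odd
  \<open>r\<close>, and \<open>z ^ (r + 2) = - (z ^ 2)\<close>.\<close>

lemma unity_root_conj_minus_square:
  assumes "z ^ r = - 1" "odd r" "ieval f z = 0"
  shows "ieval f (- (z ^ 2)) = 0"
proof -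
  have "coprime (r + 2) (2 * r)"
  proof -
    have "gcd r (r + 2) = gcd r 2" by (rule gcd_add2)
    moreover have "coprime r 2" using assms(2) by simp
    ultimately have "coprime (r + 2) r"
      by (simp only: coprime_iff_gcd_eq_1 gcd.commute[of "r + 2" r])
    moreover have "coprime (r + 2) 2" using assms(2) by simp
    ultimately show ?thesis by simp
  qed
  moreover have "z ^ (2 * r) = 1" using assms(1) by (simp add: mult.commute[of 2] power_mult)
  ultimately have "ieval f (z ^ (r + 2)) = 0"
    using assms by (intro unity_root_conj[of z "2 * r"]) (auto simp: odd_pos)
  then show ?thesis using assms(1) by (simp add: power_add power2_eq_square)
qed

text \<open>The exponent \<open>h + 1\<close> is coprime to \<open>2 * h\<close> for even
  \<open>h\<close>, and \<open>z ^ (h + 1) = - z\<close>.\<close>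

lemma unity_root_conj_minus:
  assumes "z ^ h = - 1" "even h" "ieval f z = 0"
  shows "ieval f (- z) = 0"
proof -
  have "h \<noteq> 0" using assms(1) by (intro notI) simp
  moreover have "coprime (h + 1) (2 * h)"
  proof -
    have "coprime (h + 1) 2" using assms(2) by simp
    moreover have "coprime (h + 1) h" by (simp add: coprime_commute)
    ultimately show ?thesis by simp
  qed
  moreover have "z ^ (2 * h) = 1" using assms(1) by (simp add: mult.commute[of 2] power_mult)
  ultimately have "ieval f (z ^ (h + 1)) = 0"
    using assms by (intro unity_root_conj[of z "2 * h"]) auto
  then show ?thesis using assms(1) by simp
qed

section \<open>Orders of the roots of small cyclotomic polynomials\<close>

lemma power_eq_1_dvd_3:
  fixes u :: complex
  assumes "u ^ 2 + u + 1 = 0" "u ^ k = 1"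
  shows "3 dvd k"
proof -
  have u3: "u ^ 3 = 1" using assms(1) by algebra
  have "u ^ k = u ^ (3 * (k div 3) + k mod 3)" by simp
  also have "\<dots> = u ^ (k mod 3)" by (simp only: power_add power_mult u3) simp
  finally have *: "u ^ (k mod 3) = 1" using assms(2) by simp
  have "k mod 3 < 3" by simp
  then consider "k mod 3 = 0" | "k mod 3 = 1" | "k mod 3 = 2" by linarith
  then show ?thesis
  proof cases
    case 2
    then have "u = 1" using * by simp
    with assms(1) show ?thesis by simp
  next
    case 3
    then have "u ^ 2 = 1" using * by simp
    with assms(1) have False by algebra
    then show ?thesis ..
  qed auto
qed

lemma power_eq_1_dvd_5:
  fixes u :: complex
  assumes "u ^ 4 + u ^ 3 + u ^ 2 + u + 1 = 0" "u ^ k = 1"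
  shows "5 dvd k"
proof -
  have u5: "u ^ 5 = 1" using assms(1) by algebra
  have "u ^ k = u ^ (5 * (k div 5) + k mod 5)" by simp
  also have "\<dots> = u ^ (k mod 5)" by (simp only: power_add power_mult u5) simp
  finally have *: "u ^ (k mod 5) = 1" using assms(2) by simp
  have "u \<noteq> 1" "u ^ 2 \<noteq> 1" "u ^ 3 \<noteq> 1" "u ^ 4 \<noteq> 1"
    by (rule notI, use assms(1) in algebra)+
  moreover have "k mod 5 < 5" by simp
  then have "k mod 5 = 0 \<or> k mod 5 = 1 \<or> k mod 5 = 2 \<or> k mod 5 = 3 \<or> k mod 5 = 4" by linarith
  ultimately have "k mod 5 = 0" using * by auto
  then show ?thesis by auto
qed

lemma minus_1_power_eq_1:
  fixes u :: complex
  assumes "u ^ d = - 1" "u ^ k = 1"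
  shows "even k"
proof (rule ccontr)
  assume "odd k"
  then have "(- 1 :: complex) ^ k = - 1" by simp
  moreover have "(- 1 :: complex) ^ k = (u ^ k) ^ d"
    unfolding assms(1)[symmetric] by (simp add: mult.commute flip: power_mult)
  ultimately show False using assms(2) by simp
qed

lemma power_eq_1_dvd_6:
  fixes z :: complex
  assumes "z ^ 2 - z + 1 = 0" "z ^ k = 1"
  shows "6 dvd k"
proof -
  have "z ^ 3 = - 1" using assms(1) by algebra
  then have "even k" using minus_1_power_eq_1 assms(2) by blast
  moreover have "3 dvd k"
  proof (rule power_eq_1_dvd_3)
    show "(z ^ 2) ^ 2 + z ^ 2 + 1 = 0" using assms(1) by algebra
    have "(z ^ 2) ^ k = (z ^ k) ^ 2" by (simp add: mult.commute flip: power_mult)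
    then show "(z ^ 2) ^ k = 1" using assms(2) by simp
  qed
  ultimately show ?thesis by presburger
qed

lemma power_eq_1_dvd_4:
  fixes z :: complex
  assumes "z ^ 2 = - 1" "z ^ k = 1"
  shows "4 dvd k"
proof -
  have "even k" using minus_1_power_eq_1 assms by blast
  then obtain j where j: "k = 2 * j" by blast
  then have "(- 1 :: complex) ^ j = 1" using assms by (simp add: power_mult)
  then have "even j" by (cases "even j") auto
  with j show ?thesis by auto
qed

section \<open>Determination of all roots of unity among the roots\<close>

lemma unity_root_norm:
  assumes "z ^ n = 1" "n > 0"
  shows "cmod z = 1"
  using power_eq_imp_eq_norm[of z n 1] assms by simp

lemma D_even_root_eq:
  assumes "ieval (D_poly l (2 * w)) z = 0" "w \<ge> 1"
  shows "(z - 1) * (z ^ w + 1) = of_real (real l - 2) * (z ^ w - z)"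
  using D_even_identity[OF assms(2), of z l] assms(1) by simp

lemma D_odd_root_eq:
  assumes "ieval (D_poly l (Suc (2 * w))) z = 0" "w \<ge> 1"
  shows "(z - 1) * (z ^ w + 1) ^ 2 = of_real (real l - 2) * ((z ^ w) ^ 2 - z)"
  using D_odd_identity[OF assms(2), of z l] assms(1) by (simp add: mult.commute flip: power_mult)

text \<open>The three kinds of order are treated with the conjugates \<open>z ^ 2\<close>,
  \<open>- (z ^ 2)\<close> and \<open>- z\<close>; the parity of \<open>w\<close> fixes the sign of
  their w-th powers.\<close>

proposition D_even_unity_root:
  assumes l: "l \<ge> 3" and w: "w \<ge> 2" and lm: "(int l - 2) * (int (2 * w) - 2) > 4"
    and z: "ieval (D_poly l (2 * w)) z = 0" "z ^ n = 1" "n > 0"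
  shows "(z = - 1 \<and> odd w) \<or> (l = 3 \<and> 2 * w mod 12 = 4)"
proof -
  define q where "q = real l - 2"
  define t where "t = z ^ w"
  have q: "q \<ge> 1" using l by (simp add: q_def)
  have q0: "complex_of_real q + a \<noteq> 0" if "Re a \<ge> 0" for a using q that by (auto simp: complex_eq_iff)
  have nz: "cmod z = 1" using unity_root_norm z(2,3) .
  have nt: "cmod t = 1" by (simp add: t_def norm_power nz)
  have root_eq: "(x - 1) * (x ^ w + 1) = of_real q * (x ^ w - x)" if "ieval (D_poly l (2 * w)) x = 0" for x
    unfolding q_def using w by (intro D_even_root_eq that) simp
  have z1: "z \<noteq> 1" using ieval_D_poly_1[OF _ lm] w z(1) by auto
  note G = root_eq[OF z(1), folded t_def]
  have zt: "z ^ 2 = 1" if "z * t = 1"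
  proof -
    have "(of_real q + 1) * (z ^ 2 - 1) = 0" using G that by algebra
    then show ?thesis using q0[of 1] by simp
  qed
  have t1: "t \<noteq> 1"
  proof
    assume "t = 1"
    then have "(of_real q + 2) * (z - 1) = 0" using G by algebra
    then show False using q0[of 2] z1 by simp
  qed
  show ?thesis using z(2,3)
  proof (cases rule: unity_root_cases)
    case (1 N)
    have "ieval (D_poly l (2 * w)) (z ^ 2) = 0" using unity_root_conj_square 1 z(1) by blast
    from root_eq[OF this] have "(z ^ 2 - 1) * (t ^ 2 + 1) = of_real q * (t ^ 2 - z ^ 2)"
      by (simp add: t_def mult.commute flip: power_mult)
    from even_elim_square[OF G this] z1 t1 have "z ^ 2 = 1" using zt by simp
    \<comment> \<open>The other solution \<open>z = - 1\<close> contradicts \<open>z ^ N = 1\<close>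
      with \<open>N\<close> odd.\<close>
    then have "z = 1" using 1 by (auto simp: power2_eq_1_iff)
    with z1 show ?thesis by simp
  next
    case (2 r)
    have "ieval (D_poly l (2 * w)) (- (z ^ 2)) = 0" using unity_root_conj_minus_square 2 z(1) by blast
    note * = root_eq[OF this]
    show ?thesis
    proof (cases "even w")
      case False
      then have "(- (z ^ 2) - 1) * (- (t ^ 2) + 1) = of_real q * (- (t ^ 2) + z ^ 2)"
        using * by (simp add: t_def mult.commute flip: power_mult)
      from even_elim_minus_square[OF G this] consider "t = - 1" | "z = - 1" | "z * t = 1"
        by (auto simp: eq_neg_iff_add_eq_0)
      then have "z = - 1"
      proof cases
        case 1
        then have "of_real q * (z + 1) = 0" using G by algebra
        then show ?thesis using q0[of 0] by (simp add: eq_neg_iff_add_eq_0)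
      next
        case 3
        then show ?thesis using zt z1 by (auto simp: power2_eq_1_iff)
      qed
      with False show ?thesis by simp
    next
      case True
      then have "(- (z ^ 2) - 1) * (t ^ 2 + 1) = of_real q * (t ^ 2 + z ^ 2)"
        using * by (simp add: t_def mult.commute flip: power_mult)
      from even_elim_minus_square'[OF G this] q0[of 2]
      have a: "(z * t) ^ 2 + 2 * of_real q * (z * t) + 1 = 0" by simp
      \<comment> \<open>Since \<open>z * t\<close> has modulus 1, comparing moduli gives
        \<open>2 * q <= 2\<close>; hence \<open>q = 1\<close> and the quadratic is
        \<open>(z * t + 1) ^ 2\<close>.\<close>
      then have "2 * of_real q * (z * t) = - ((z * t) ^ 2 + 1)" by algebra
      then have "cmod (2 * of_real q * (z * t)) = cmod (- ((z * t) ^ 2 + 1))" by (rule arg_cong)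
      then have "2 * q * cmod (z * t) = cmod ((z * t) ^ 2 + 1)"
        using q by (simp only: norm_mult norm_of_real norm_minus_cancel norm_numeral)
      also have "\<dots> \<le> cmod ((z * t) ^ 2) + 1" using norm_triangle_ineq[of "(z * t) ^ 2" 1] by simp
      finally have q1: "q = 1" using q by (simp add: norm_mult norm_power nz nt)
      then have "(z * t + 1) ^ 2 = 0" using a by (simp add: power2_eq_square algebra_simps)
      then have zt': "z * t = - 1" by (simp add: eq_neg_iff_add_eq_0)
      have "(z - 1) * (t + 1) = t - z" using G q1 by simp
      then have t': "t = z - 1" using zt' by algebra
      then have ph: "z ^ 2 - z + 1 = 0" using zt' by algebra
      \<comment> \<open>The shift by 4 is chosen because \<open>t = z - 1 = z ^ 2\<close> and
        \<open>z ^ 6 = 1\<close>.\<close>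
      have "z ^ (w + 4) = t * z ^ 4" by (simp only: power_add t_def)
      also have "\<dots> = 1" using ph t' by algebra
      finally have "6 dvd w + 4" by (rule power_eq_1_dvd_6[OF ph])
      then have "2 * w mod 12 = 4" by presburger
      moreover have "l = 3" using q1 by (simp add: q_def)
      ultimately show ?thesis by simp
    qed
  next
    case (3 h)
    have "ieval (D_poly l (2 * w)) (- z) = 0" using unity_root_conj_minus 3 z(1) by blast
    note * = root_eq[OF this]
    show ?thesis
    proof (cases "even w")
      case True
      then have "(- z - 1) * (t + 1) = of_real q * (t + z)" using * by (simp add: t_def)
      \<comment> \<open>Adding the equations at \<open>z\<close> and \<open>- z\<close> removes
        \<open>z\<close>; then \<open>t\<close> would have modulus \<open>1 / (q + 1)\<close>, below
        1.\<close>
      then have "(of_real q + 1) * t = - 1" using G by algebra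
      then have "cmod (of_real (q + 1) * t) = 1" by simp
      then show ?thesis using q nt by (simp only: norm_mult norm_of_real) simp
    next
      case False
      then have "(- z - 1) * (- t + 1) = of_real q * (- t + z)" using * by (simp add: t_def)
      from zt[OF even_elim_minus[OF G this]] obtain k where "z ^ 2 = 1" "h = 2 * k" using 3 by blast
      with 3 show ?thesis by (simp add: power_mult)
    qed
  qed
qed

text \<open>The roots lie on the unit circle, so modulus alone does not decide. The conjugate
  dictated by the order gives a second equation, from which \<open>u = - 2\<close> or
  \<open>u = 0\<close> would follow.\<close>

lemma not_unity_root_2_1_2:
  fixes u :: complex
  assumes "u ^ n = 1" "n > 0"
  shows "2 * u ^ 2 + u + 2 \<noteq> 0"
proof
  assume u: "2 * u ^ 2 + u + 2 = 0"
  define f where "f = [:2, 1, 2 :: int:]"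
  have f: "ieval f x = 2 * x ^ 2 + x + 2" for x
    by (simp add: f_def map_poly_pCons power2_eq_square algebra_simps)
  have nu: "cmod u = 1" using assms by (rule unity_root_norm)
  have 2: "u \<noteq> - 2" "u \<noteq> 0" using nu by auto
  show False using assms
  proof (cases rule: unity_root_cases)
    case (1 N)
    have "ieval f (u ^ 2) = 0" using unity_root_conj_square[OF 1(2,1), of f] u f by simp
    then have "2 * u ^ 4 + u ^ 2 + 2 = 0" by (simp add: f flip: power_mult)
    then have "u + 2 = 0" using u by algebra
    with 2 show False by (simp add: eq_neg_iff_add_eq_0)
  next
    case (2 r)
    have "ieval f (- (u ^ 2)) = 0" using unity_root_conj_minus_square[OF 2(2,1), of f] u f by simp
    then have "2 * u ^ 4 - u ^ 2 + 2 = 0" by (simp add: f flip: power_mult)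
    then have "u + 2 = 0" using u by algebra
    with \<open>u \<noteq> - 2\<close> show False by (simp add: eq_neg_iff_add_eq_0)
  next
    case (3 h)
    have "ieval f (- u) = 0" using unity_root_conj_minus[OF 3(2,1), of f] u f by simp
    then have "2 * u ^ 2 - u + 2 = 0" by (simp add: f)
    then have "u = 0" using u by algebra
    with 2 show False by simp
  qed
qed

text \<open>The elimination with \<open>- (z ^ 2)\<close> in terms of real numbers. Here
  \<open>s\<close> is \<open>t ^ 2 + 1 = t * y\<close> for even \<open>w\<close> and
  \<open>1 - t ^ 2\<close> for odd \<open>w\<close>, which accounts for the two values of
  \<open>e\<close>.\<close>

lemma D_odd_unity_root_minus_square:
  assumes w: "w \<ge> 1"
    and z: "ieval (D_poly l (Suc (2 * w))) z = 0" "z ^ r = - 1" "odd r"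
    and q_def: "q = real l - 2"
    and y_def: "y = 2 * Re (z ^ w)"
  shows "(if even w then y ^ 2 else y ^ 2 - 4) * sym_form q y + q * twisted_form q y = 0"
proof -
  define t where "t = z ^ w"
  have "(z ^ r) ^ 2 = 1" using z(2) by simp
  then have "z ^ (2 * r) = 1" by (simp add: mult.commute flip: power_mult)
  then have nz: "cmod z = 1" using z(3) by (intro unity_root_norm[of z "2 * r"]) (auto simp: odd_pos)
  have nt: "cmod t = 1" by (simp add: t_def norm_power nz)
  have y: "t ^ 2 + 1 = t * of_real y" using unit_circle_quadratic[OF nt] by (simp add: y_def t_def)
  note G = D_odd_root_eq[OF z(1) w, folded q_def t_def]
  have "ieval (D_poly l (Suc (2 * w))) (- (z ^ 2)) = 0"
    using unity_root_conj_minus_square z by blast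
  note B = D_odd_root_eq[OF this w, folded q_def]
  define e :: real where "e = (if even w then y ^ 2 else y ^ 2 - 4)"
  define s where "s = (- (z ^ 2)) ^ w + 1"
  have tw: "(z ^ 2) ^ w = t ^ 2" by (simp add: t_def mult.commute flip: power_mult)
  have "((- (z ^ 2)) ^ w) ^ 2 = t ^ 4"
  proof -
    have "((- (z ^ 2)) ^ w) ^ 2 = ((z ^ 2) ^ w) ^ 2" by (cases "even w") simp_all
    also have "\<dots> = t ^ 4" unfolding tw by (simp flip: power_mult)
    finally show ?thesis .
  qed
  then have B': "(- (z ^ 2) - 1) * s ^ 2 = of_real q * (t ^ 4 + z ^ 2)"
    using B by (simp add: s_def)
  have s: "s ^ 2 = t ^ 2 * of_real e"
  proof (cases "even w")
    case True
    then have "s = t ^ 2 + 1" by (simp add: s_def tw)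
    then show ?thesis using y True by (simp add: e_def power_mult_distrib)
  next
    case False
    then have "s = 1 - t ^ 2" by (simp add: s_def tw)
    then have "s ^ 2 = t ^ 2 * (of_real y ^ 2 - 4)" using y by algebra
    then show ?thesis using False by (simp add: e_def)
  qed
  have "t \<noteq> 0" using nt by auto
  then have "complex_of_real e * sym_form (of_real q) (of_real y) + of_real q * twisted_form (of_real q) (of_real y) = 0"
    using odd_elim_minus_square[OF G B' y s] by simp
  moreover have "complex_of_real e * sym_form (of_real q) (of_real y) + of_real q * twisted_form (of_real q) (of_real y)
      = of_real (e * sym_form q y + q * twisted_form q y)" by (simp add: sym_form_def twisted_form_def)
  ultimately show ?thesis unfolding e_def[symmetric] by (simp only: of_real_eq_0_iff)
qed

text \<open>Each conjugate gives a condition on \<open>q\<close> and \<open>y\<close> that is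
  contradictory or fixes both, then \<open>t\<close> and \<open>z\<close>. Expressing
  \<open>t\<close> through \<open>z\<close> in \<open>t = z ^ w\<close> turns the order of
  \<open>z\<close> into a congruence for \<open>w\<close>.\<close>

proposition D_odd_unity_root:
  assumes l: "l \<ge> 3" and w: "w \<ge> 1" and lm: "(int l - 2) * (int (Suc (2 * w)) - 2) > 4"
    and z: "ieval (D_poly l (Suc (2 * w))) z = 0" "z ^ n = 1" "n > 0"
  shows "(l = 3 \<and> Suc (2 * w) mod 6 = 3) \<or> (l = 3 \<and> Suc (2 * w) mod 20 = 5) \<or>
    (l = 4 \<and> Suc (2 * w) mod 8 = 3) \<or> (l = 5 \<and> Suc (2 * w) mod 12 = 3)"
proof -
  let ?D = "D_poly l (Suc (2 * w))"
  define q where "q = real l - 2"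
  define t where "t = z ^ w"
  define y where "y = 2 * Re t"
  have q: "q \<ge> 1" using l by (simp add: q_def)
  have q0: "complex_of_real q + a \<noteq> 0" if "Re a \<ge> 0" for a using q that by (auto simp: complex_eq_iff)
  have nz: "cmod z = 1" using unity_root_norm z(2,3) .
  have nt: "cmod t = 1" by (simp add: t_def norm_power nz)
  then have t0: "t \<noteq> 0" by auto
  have tn: "t ^ n = 1"
    using arg_cong[OF z(2), of "\<lambda>x. x ^ w"] by (simp add: t_def mult.commute flip: power_mult)
  have yeq: "t ^ 2 + 1 = t * of_real y" using unit_circle_quadratic[OF nt] by (simp add: y_def)
  have y2: "\<bar>y\<bar> \<le> 2" using abs_Re_le_cmod[of t] nt by (simp add: y_def)
  have root_eq: "(x - 1) * (x ^ w + 1) ^ 2 = of_real q * ((x ^ w) ^ 2 - x)" if "ieval ?D x = 0" for x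
    unfolding q_def using w by (intro D_odd_root_eq that) simp
  have z1: "z \<noteq> 1" using ieval_D_poly_1[OF _ lm] w z(1) by auto
  note G = root_eq[OF z(1), folded t_def]
  have t1: "t \<noteq> 1"
  proof
    assume "t = 1"
    then have "(of_real q + 4) * (z - 1) = 0" using G by algebra
    then show False using q0[of 4] z1 by simp
  qed
  have tm1: "t \<noteq> - 1"
  proof
    assume "t = - 1"
    then have "of_real q * (z - 1) = 0" using G by algebra
    then show False using q0[of 0] z1 by simp
  qed
  have yof: "of_real y = c \<Longrightarrow> t ^ 2 + 1 = t * c" for c using yeq by simp
  show ?thesis using z(2,3)
  proof (cases rule: unity_root_cases)
    case (1 N)
    have "ieval ?D (z ^ 2) = 0" using unity_root_conj_square 1 z(1) by blast
    from root_eq[OF this] have "(z ^ 2 - 1) * (t ^ 2 + 1) ^ 2 = of_real q * (t ^ 4 - z ^ 2)"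
      by (simp add: t_def mult.commute flip: power_mult)
    from odd_elim_square[OF G this] z1 t1
    have zt: "z * (t * (t ^ 2 + t + 2)) = 2 * t ^ 2 + t + 1" by simp
    from odd_elim_square_real[OF G zt yeq] t1 t0
    have "complex_of_real ((q + 1) * (y + 1) ^ 2 + q - 1) = 0" by simp
    then have "(q + 1) * (y + 1) ^ 2 + q - 1 = 0" by (simp only: of_real_eq_0_iff)
    moreover have "(q + 1) * (y + 1) ^ 2 \<ge> 0" using q by simp
    ultimately have "q = 1" "(q + 1) * (y + 1) ^ 2 = 0" using q by linarith+
    then have y1: "y = - 1" by simp
    then have "t ^ 2 + 1 = t * (- 1)" by (intro yof) simp
    then have ph: "t ^ 2 + t + 1 = 0" by algebra
    then have "z = t" using zt by algebra
    then have ph': "z ^ 2 + z + 1 = 0" using ph by simp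
    have "z ^ (w + 2) = t * z ^ 2" by (simp only: power_add t_def)
    also have "\<dots> = 1" using ph' \<open>z = t\<close> by algebra
    finally have "3 dvd w + 2" by (rule power_eq_1_dvd_3[OF ph'])
    then have "Suc (2 * w) mod 6 = 3" by presburger
    moreover have "l = 3" using \<open>q = 1\<close> by (simp add: q_def)
    ultimately show ?thesis by simp
  next
    case (2 r)
    \<comment> \<open>\<open>t\<close> is a power of \<open>z\<close>, whose order is not divisible
      by 4 as \<open>z ^ r = - 1\<close> with \<open>r\<close> odd. This rules out
      \<open>y = 0\<close>.\<close>
    have tr: "t ^ 2 \<noteq> - 1"
    proof
      assume "t ^ 2 = - 1"
      moreover have "(t ^ 2) ^ r = (z ^ r) ^ (2 * w)"
        by (simp add: t_def mult_ac flip: power_mult)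
      ultimately show False using 2 by simp
    qed
    then have y0: "y \<noteq> 0" using yeq by (auto simp: eq_neg_iff_add_eq_0)
    note S = D_odd_unity_root_minus_square[OF w z(1) 2(2,1) q_def y_def[unfolded t_def]]
    show ?thesis
    proof (cases "even w")
      case True
      then have S3: "(q + 1) * y ^ 2 * ((q + 2) * y + 4) ^ 2 + 2 * q * (q - 2) * (y + q + 2) ^ 2 = 0"
        using S S_plus_identity[of q y] by simp
      have "l = 3 \<or> l = 4 \<or> l \<ge> 5" using l by linarith
      moreover have False if "l \<ge> 5"
      proof -
        have "q \<ge> 3" using that by (simp add: q_def)
        \<comment> \<open>The square is positive because \<open>y >= - 2\<close> and
          \<open>q >= 3\<close>.\<close>
        then have "2 * q * (q - 2) * (y + q + 2) ^ 2 > 0" using y2 by (intro mult_pos_pos) auto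
        moreover have "(q + 1) * y ^ 2 * ((q + 2) * y + 4) ^ 2 \<ge> 0" using q by simp
        ultimately show False using S3 by linarith
      qed
      moreover have False if "l = 4"
      proof -
        have "q = 2" using that by (simp add: q_def)
        \<comment> \<open>For \<open>q = 2\<close> the second summand drops out and the first is a
          multiple of \<open>y ^ 2 * (y + 1) ^ 2\<close>.\<close>
        then have "y = - 1" using S3 y0 by simp
        then have "t ^ 2 + 1 = t * (- 1)" by (intro yof) simp
    then have ph: "t ^ 2 + t + 1 = 0" by algebra
        have "(z + 1) * (t + 2) = 0" using ph G arg_cong[OF \<open>q = 2\<close>, of complex_of_real] unfolding of_real_numeral by algebra
        moreover have "t \<noteq> - 2" using nt by auto
        ultimately have "z = - 1" by (simp add: eq_neg_iff_add_eq_0)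
        then show False using True t1 by (simp add: t_def)
      qed
      ultimately have l3: "l = 3" by blast
      have "q = 1" using l3 by (simp add: q_def)
      then have "2 * y ^ 2 * (3 * y + 4) ^ 2 - 2 * (y + 3) ^ 2 = 0" using S3 by (simp add: add.commute)
      \<comment> \<open>A difference of squares: \<open>y * (3 * y + 4)\<close> and
        \<open>y + 3\<close> agree up to sign.\<close>
      then have "(y ^ 2 + y - 1) * (3 * y ^ 2 + 5 * y + 3) = 0" by algebra
      moreover have "12 * (3 * y ^ 2 + 5 * y + 3) = (6 * y + 5) ^ 2 + 11" by algebra
      then have "3 * y ^ 2 + 5 * y + 3 \<noteq> 0" by (smt (verit) zero_le_power2)
      ultimately have "y ^ 2 + y - 1 = 0" by simp
      then have "complex_of_real (y ^ 2 + y - 1) = 0" by simp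
      then have yc: "complex_of_real y ^ 2 + of_real y - 1 = 0" by simp
      \<comment> \<open>The golden-ratio equation for \<open>t + 1 / t\<close> makes
        \<open>t\<close> a primitive fifth root of unity.\<close>
      have ph: "t ^ 4 + t ^ 3 + t ^ 2 + t + 1 = 0" using yeq yc by algebra
      have G1: "(z - 1) * (t + 1) ^ 2 = t ^ 2 - z" using G \<open>q = 1\<close> by simp
      have "(z + t ^ 3) * (t ^ 2 + 2 * t + 2) = 0" using G1 ph by algebra
      moreover have "t ^ 2 + 2 * t + 2 \<noteq> 0" using ph t1 by (intro notI) algebra
      ultimately have zt: "z = - (t ^ 3)" by (simp add: eq_neg_iff_add_eq_0)
      have z5: "z ^ 5 = - 1" and z2: "z ^ 2 = t" using zt ph by algebra+
      have "z ^ (w + 8) = t * z ^ 8" by (simp only: power_add t_def)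
      also have "\<dots> = 1" using zt ph by algebra
      finally have z8: "z ^ (w + 8) = 1" .
      then have "even (w + 8)" by (rule minus_1_power_eq_1[OF z5])
      moreover have "t ^ (w + 8) = (z ^ (w + 8)) ^ 2"
        unfolding z2[symmetric] by (simp add: mult.commute flip: power_mult)
      then have "5 dvd w + 8" using z8 by (intro power_eq_1_dvd_5[OF ph]) simp
      ultimately have "Suc (2 * w) mod 20 = 5" by presburger
      with l3 show ?thesis by simp
    next
      case False
      \<comment> \<open>The conjugate \<open>z'\<close> satisfies the same hypotheses as
        \<open>z\<close>, so the criterion applies to it as well, with \<open>2 - y ^ 2\<close> in
        place of \<open>y\<close>.\<close>
      define z' where "z' = - (z ^ 2)"
      have z'r: "z' ^ r = - 1"
      proof -
        have "(z ^ 2) ^ r = (z ^ r) ^ 2" by (simp add: mult.commute flip: power_mult)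
        then show ?thesis using 2 by (simp add: z'_def)
      qed
      have "ieval ?D z' = 0" unfolding z'_def using unity_root_conj_minus_square 2 z(1) by blast
      note S' = D_odd_unity_root_minus_square[OF w this z'r 2(1) q_def refl]
      have "z' ^ w = - (t ^ 2)" using False
        by (simp add: z'_def t_def mult.commute flip: power_mult)
      moreover have "t ^ 2 = t * of_real y - 1" using yeq by (simp add: algebra_simps)
      ultimately have "2 * Re (z' ^ w) = 2 - y ^ 2" by (simp add: y_def power2_eq_square)
      note S'' = S'[unfolded this]
      have A: "(y ^ 2 - 4) * sym_form q y + q * twisted_form q y = 0"
        "((2 - y ^ 2) ^ 2 - 4) * sym_form q (2 - y ^ 2) + q * twisted_form q (2 - y ^ 2) = 0"
        using S S'' False by simp_all
      have "l = 3 \<or> l = 4 \<or> l \<ge> 5" using l by linarith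
      moreover have False if "l = 3"
        using A S_minus_1[of y] that by (simp add: q_def)
      moreover have False if "l = 4"
      proof -
        have "2 - y ^ 2 \<noteq> 0"
        proof
          assume "2 - y ^ 2 = 0"
          then have "complex_of_real (2 - y ^ 2) = 0" by simp
          then have "complex_of_real y ^ 2 = 2" by simp
          \<comment> \<open>\<open>y ^ 2 = 2\<close> would make \<open>t\<close> a primitive eighth
            root of unity, again against the order of \<open>z\<close>.\<close>
          then have "(t ^ 2 + 1) ^ 2 = 2 * t ^ 2" using yeq by (simp add: power_mult_distrib)
          then have t4: "t ^ 4 = - 1" by algebra
          moreover have "(t ^ 4) ^ r = (z ^ r) ^ (4 * w)"
            by (simp add: t_def mult_ac flip: power_mult)
          ultimately show False using 2 by (simp add: power_mult)
        qed
        then show False using A S_minus_2[of y] that y0 by (simp add: q_def)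
      qed
      ultimately have l5: "l \<ge> 5" by blast
      then have q3: "q - 3 \<ge> 0" by (simp add: q_def)
      have p1: "(y ^ 2 - 3) ^ 2 + 2 * (y + 1) ^ 2 + 15 > 0"
        and p2: "(3 * y ^ 2 + 4 / 3 * y - 6) ^ 2 + 38 / 9 * (y + 36 / 19) ^ 2 + 814 / 19 > 0"
        and p3: "10 * (y + 9 / 5) ^ 2 + 13 / 5 > 0"
        by (intro add_nonneg_pos add_nonneg_nonneg; simp)+
      have p4: "2 * (q - 3) ^ 3 \<ge> 0"
        "(q - 3) ^ 2 * ((y ^ 2 - 3) ^ 2 + 2 * (y + 1) ^ 2 + 15) \<ge> 0"
        "(q - 3) * ((3 * y ^ 2 + 4 / 3 * y - 6) ^ 2 + 38 / 9 * (y + 36 / 19) ^ 2 + 814 / 19) \<ge> 0"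
        "2 * (y - 1) ^ 2 * (10 * (y + 9 / 5) ^ 2 + 13 / 5) \<ge> 0"
      proof -
        show "2 * (q - 3) ^ 3 \<ge> 0" using zero_le_power[OF q3, of 3] by simp
        show "(q - 3) ^ 2 * ((y ^ 2 - 3) ^ 2 + 2 * (y + 1) ^ 2 + 15) \<ge> 0"
          by (rule mult_nonneg_nonneg[OF zero_le_power2 less_imp_le[OF p1]])
        show "(q - 3) * ((3 * y ^ 2 + 4 / 3 * y - 6) ^ 2 + 38 / 9 * (y + 36 / 19) ^ 2 + 814 / 19) \<ge> 0"
          by (rule mult_nonneg_nonneg[OF q3 less_imp_le[OF p2]])
        show "2 * (y - 1) ^ 2 * (10 * (y + 9 / 5) ^ 2 + 13 / 5) \<ge> 0"
          by (rule mult_nonneg_nonneg[OF _ less_imp_le[OF p3]]) simp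
      qed
      \<comment> \<open>Four nonnegative summands add up to zero, so each vanishes; the last two
        determine \<open>q\<close> and \<open>y\<close>.\<close>
      note sum0 = A(1)[unfolded S_minus_identity]
      have "(q - 3) * ((3 * y ^ 2 + 4 / 3 * y - 6) ^ 2 + 38 / 9 * (y + 36 / 19) ^ 2 + 814 / 19) = 0"
        "2 * (y - 1) ^ 2 * (10 * (y + 9 / 5) ^ 2 + 13 / 5) = 0"
        using sum0 p4 by linarith+
      then have "q - 3 = 0" "2 * (y - 1) ^ 2 = 0"
        using p2 p3 by (auto simp only: mult_eq_0_iff)
      then have "q = 3" "y = 1" by simp_all
      have "t ^ 2 + 1 = t * 1" using \<open>y = 1\<close> by (intro yof) simp
      then have ph: "t ^ 2 - t + 1 = 0" by algebra
      have "(z - t) * (t + 1) = 0" using G ph arg_cong[OF \<open>q = 3\<close>, of complex_of_real] unfolding of_real_numeral by algebra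
      then have "z = t" using tm1 by (simp add: eq_neg_iff_add_eq_0)
      have "z ^ (w + 5) = t * z ^ 5" by (simp only: power_add t_def)
      also have "\<dots> = 1" using ph \<open>z = t\<close> by algebra
      finally have "6 dvd w + 5" using power_eq_1_dvd_6[of z] ph \<open>z = t\<close> by simp
      then have "Suc (2 * w) mod 12 = 3" by presburger
      moreover have "l = 5" using \<open>q = 3\<close> by (simp add: q_def)
      ultimately show ?thesis by simp
    qed
  next
    case (3 h)
    have "ieval ?D (- z) = 0" using unity_root_conj_minus 3 z(1) by blast
    note * = root_eq[OF this]
    show ?thesis
    proof (cases "even w")
      case True
      then have "(- z - 1) * (t + 1) ^ 2 = of_real q * (t ^ 2 + z)" using * by (simp add: t_def)
      \<comment> \<open>The sum of the two equations no longer contains \<open>z\<close>; with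
        \<open>(t + 1) ^ 2 = t * (y + 2)\<close> it makes \<open>t\<close> real, hence 1 or
        -1.\<close>
      then have "(t + 1) ^ 2 = - (of_real q * t ^ 2)" using G by algebra
      then have "t * (of_real y + 2 + of_real q * t) = 0" using yeq by algebra
      then have "of_real y + 2 + of_real q * t = 0" using t0 by simp
      then have "of_real q * t = of_real (- (y + 2))" by (simp add: eq_neg_iff_add_eq_0 algebra_simps)
      then have "t = of_real (- (y + 2) / q)" using q by (simp add: field_simps)
      then obtain x where x: "t = of_real x" by blast
      then have "x = 1 \<or> x = - 1" using nt by auto
      then show ?thesis using x t1 tm1 by auto
    next
      case False
      then have "(- z - 1) * (- t + 1) ^ 2 = of_real q * (t ^ 2 + z)" using * by (simp add: t_def)
      from odd_elim_minus[OF G this yeq] t0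
      have "complex_of_real ((q + 1) * y ^ 2 + q ^ 2 - 4) = 0" by simp
      then have qy: "(q + 1) * y ^ 2 + q ^ 2 - 4 = 0" by (simp only: of_real_eq_0_iff)
      have "l = 3 \<or> l = 4 \<or> l \<ge> 5" using l by linarith
      moreover have False if "l = 3"
      proof -
        \<comment> \<open>This becomes \<open>2 * u ^ 2 + u + 2 = 0\<close> for
          \<open>u = t ^ 2\<close>, which has no root of unity among its solutions.\<close>
        have "2 * y ^ 2 = 3" using qy that by (simp add: q_def)
        then have "complex_of_real (2 * y ^ 2) = 3" by simp
        then have "2 * complex_of_real y ^ 2 = 3" by simp
        moreover have "2 * (t ^ 2 + 1) ^ 2 = t ^ 2 * (2 * complex_of_real y ^ 2)"
          unfolding yeq by (simp add: power_mult_distrib)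
        ultimately have "2 * (t ^ 2 + 1) ^ 2 = t ^ 2 * 3" by (simp only:)
        then have "2 * (t ^ 2) ^ 2 + t ^ 2 + 2 = 0" by algebra
        moreover have "(t ^ 2) ^ n = (t ^ n) ^ 2" by (simp add: mult.commute flip: power_mult)
        then have "(t ^ 2) ^ n = 1" using tn by simp
        ultimately show False using not_unity_root_2_1_2[of "t ^ 2" n] z(3) by simp
      qed
      moreover have False if "l \<ge> 5"
      proof -
        have "q \<ge> 3" using that by (simp add: q_def)
        then have "q ^ 2 \<ge> 3 ^ 2" by (intro power_mono) auto
        moreover have "(q + 1) * y ^ 2 \<ge> 0" using q by simp
        ultimately show False using qy by simp
      qed
      ultimately have l4: "l = 4" by blast
      then have "q = 2" by (simp add: q_def)
      then have "y = 0" using qy by simp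
      then have t2: "t ^ 2 = - 1" using yeq by (simp add: eq_neg_iff_add_eq_0)
      have "(z - t) * (t + 1) = 0" using G t2 arg_cong[OF \<open>q = 2\<close>, of complex_of_real] unfolding of_real_numeral by algebra
      then have "z = t" using tm1 by (simp add: eq_neg_iff_add_eq_0)
      have "z ^ (w + 3) = t * z ^ 3" by (simp only: power_add t_def)
      also have "\<dots> = 1" using t2 \<open>z = t\<close> by algebra
      finally have "4 dvd w + 3" using power_eq_1_dvd_4[of z] t2 \<open>z = t\<close> by simp
      then have "Suc (2 * w) mod 8 = 3" by presburger
      with l4 show ?thesis by simp
    qed
  qed
qed

section \<open>Irreducibility and the exceptional factors\<close>

lemma clear_denominators:
  fixes a :: "rat poly"
  obtains c :: int and A where "c \<noteq> 0" "smult (of_int c) a = map_poly of_int A"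
proof -
  have "\<exists>(c :: int) A. c \<noteq> 0 \<and> smult (of_int c) a = map_poly of_int A"
  proof (induction a)
    case 0
    show ?case by (intro exI[of _ 1] exI[of _ 0]) simp
  next
    case (pCons x p)
    then obtain c :: int and A where cA: "c \<noteq> 0" "smult (of_int c) p = map_poly of_int A" by blast
    obtain n d where nd: "x = of_int n / of_int d" "d > 0" by (cases x) (auto simp: Fract_of_int_quotient)
    have "smult (of_int (c * d)) (pCons x p) = map_poly of_int (pCons (c * n) (smult d A))"
      using nd by (simp add: map_poly_pCons map_poly_smult mult.commute flip: cA(2))
    then show ?case using cA(1) nd(2) by (intro exI[of _ "c * d"] exI conjI) auto
  qed
  then show ?thesis using that by blast
qed

lemma has_simple_roots_smult:
  assumes "has_simple_roots f" "c \<noteq> 0"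
  shows "has_simple_roots (smult c f)"
  using assms by (simp add: has_simple_roots_def map_poly_smult)

lemma not_dvd_const_poly:
  fixes h :: "int poly"
  assumes "degree h > 0" "c \<noteq> 0"
  shows "\<not> h dvd [:c:]"
  using dvd_imp_degree_le[of h "[:c:]"] assms by auto

text \<open>Two factors of positive degree would both have to vanish at the simple root \<^term>\<open>x\<close>.\<close>
lemma irreducible_over_rat:
  fixes f :: "int poly"
  assumes f: "degree f > 0" "has_simple_roots f"
    and x: "\<And>h. prime_elem h \<Longrightarrow> degree h > 0 \<Longrightarrow> h dvd f \<Longrightarrow> ieval h x = 0"
  shows "irreducible (map_poly of_int f :: rat poly)"
proof (rule irreducibleI)
  let ?f = "map_poly of_int f :: rat poly"
  show nz: "?f \<noteq> 0" using f by auto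
  show "\<not> ?f dvd 1" using f by (simp add: is_unit_iff_degree[OF nz])
  fix a b assume ab: "?f = a * b"
  show "a dvd 1 \<or> b dvd 1"
  proof (rule ccontr)
    assume "\<not> (a dvd 1 \<or> b dvd 1)"
    moreover have "a \<noteq> 0" "b \<noteq> 0" using ab f by auto
    ultimately have deg: "degree a > 0" "degree b > 0" by (auto simp: is_unit_iff_degree)
    obtain c A where A: "c \<noteq> 0" "smult (of_int c) a = map_poly of_int A" by (rule clear_denominators)
    obtain d B where B: "d \<noteq> 0" "smult (of_int d) b = map_poly of_int B" by (rule clear_denominators)
    have eq: "(map_poly of_int (A * B) :: rat poly) = map_poly of_int (smult (c * d) f)"
      unfolding map_poly_of_int_mult A(2)[symmetric] B(2)[symmetric] by (simp add: map_poly_smult ab mult.commute)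
    have AB: "A * B = smult (c * d) f"
    proof (rule poly_eqI)
      fix n
      have "rat_of_int (coeff (A * B) n) = rat_of_int (coeff (smult (c * d) f) n)"
        using arg_cong[OF eq, of "\<lambda>p. coeff p n"] by (simp only: coeff_map_poly of_int_0)
      then show "coeff (A * B) n = coeff (smult (c * d) f) n" by (simp only: of_int_eq_iff)
    qed
    have degAB: "degree A > 0" "degree B > 0"
      using deg A(1) B(1) arg_cong[OF A(2), of degree] arg_cong[OF B(2), of degree] by simp_all
    \<comment> \<open>A prime factor of \<open>C\<close> of positive degree cannot divide the
      constant \<open>c * d\<close>, so it divides \<open>f\<close> and vanishes at
      \<open>x\<close>.\<close>
    have root: "ieval C x = 0" if C: "C dvd A * B" "degree C > 0" for C
    proof -
      obtain z where z: "ieval C z = 0" using ieval_root_exists[OF C(2)] .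
      have "C \<noteq> 0" using C(2) by auto
      then obtain h where h: "prime_elem h" "degree h > 0" "h dvd C"
        using minimal_int_poly[OF _ z] z by metis
      have "h dvd [:c * d:] * f" using dvd_trans[OF h(3) C(1)] by (simp add: AB)
      from prime_elem_dvd_multD[OF h(1) this] have "h dvd f"
        using not_dvd_const_poly[OF h(2), of "c * d"] A(1) B(1) by simp
      then show ?thesis using x h ieval_dvd by blast
    qed
    have "has_simple_roots (A * B)" unfolding AB using f(2) A(1) B(1) by (intro has_simple_roots_smult) auto
    then show False using has_simple_roots_square_free[of A B x] root[of A] root[of B] degAB by simp
  qed
qed

text \<open>A nonzero remainder would vanish at more points than its degree allows.\<close>

lemma dvd_if_roots:
  assumes p: "has_simple_roots p" "\<bar>lead_coeff p\<bar> = 1" and roots: "\<And>z. ieval p z = 0 \<Longrightarrow> ieval f z = 0"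
  shows "p dvd f"
proof -
  obtain q r where qr: "f = p * q + r" "r = 0 \<or> degree r < degree p"
    using division_by_monic[OF p(2)] .
  have "r = 0"
  proof (rule ccontr)
    assume r: "r \<noteq> 0"
    have "{z. ieval p z = 0} \<subseteq> {z. ieval r z = 0}"
    proof
      fix z assume "z \<in> {z. ieval p z = 0}"
      then have "ieval p z = 0" by simp
      moreover from roots[OF this] have "ieval p z * ieval q z + ieval r z = 0"
        by (simp add: qr(1) map_poly_of_int_hom)
      ultimately show "z \<in> {z. ieval r z = 0}" by simp
    qed
    then have "degree p \<le> card {z. ieval r z = 0}"
      using p(1) card_mono[OF finite_ieval_roots[OF r]] by (metis has_simple_roots_def)
    also have "\<dots> \<le> degree r" using card_poly_roots_bound[of "map_poly of_int r :: complex poly"] r by simp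
    finally show False using qr(2) r by simp
  qed
  then show ?thesis using qr(1) by simp
qed

lemma map_poly_of_int_id [simp]: "map_poly of_int f = (f :: int poly)"
  by (intro map_poly_idI) simp

lemma X_plus_1_dvd_D_poly:
  assumes "odd w"
  shows "[:1, 1:] dvd D_poly l (2 * w)"
proof -
  have "poly (D_poly l (2 * w)) (- 1) = 0"
    using D_even_identity[of w "- 1 :: int" l] assms by (simp add: odd_pos Suc_le_eq)
  then show ?thesis using poly_eq_0_iff_dvd[of "D_poly l (2 * w)" "- 1"] by simp
qed

text \<open>Dividing out \<open>X + 1\<close> leaves no root at -1 because the roots of the
  denominator are simple.\<close>

lemma E_poly_basic:
  assumes l: "l \<ge> 3" and m: "m \<ge> 3" and lm: "(int l - 2) * (int m - 2) > 4"
  shows "degree (E_poly l m) > 0" "\<bar>lead_coeff (E_poly l m)\<bar> = 1" "E_poly l m dvd D_poly l m"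
    "m mod 4 = 2 \<Longrightarrow> ieval (E_poly l m) (- 1) \<noteq> 0"
proof -
  note D = D_poly_basic[OF m, of l]
  have ss: "has_simple_roots (D_poly l m)" using D_poly_roots[OF assms] by blast
  have *: "D_poly l m = [:1, 1:] * E_poly l m" if "m mod 4 = 2"
  proof -
    have "m = 2 * (m div 2)" "odd (m div 2)" using that by presburger+
    then have "[:1, 1:] dvd D_poly l m" using X_plus_1_dvd_D_poly[of "m div 2" l] by simp
    from dvd_mult_div_cancel[OF this] show ?thesis using that by (simp add: E_poly_def del: mult_pCons_left)
  qed
  show dvd: "E_poly l m dvd D_poly l m"
  proof (cases "m mod 4 = 2")
    case True
    then show ?thesis using * by (metis dvd_triv_right)
  qed (simp add: E_poly_def)
  then show "\<bar>lead_coeff (E_poly l m)\<bar> = 1" using D(1) abs_lead_coeff_dvd by fastforce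
  show "degree (E_poly l m) > 0"
  proof (cases "m mod 4 = 2")
    case True
    have "E_poly l m \<noteq> 0" using dvd D(4) by auto
    then have "degree (D_poly l m) = 1 + degree (E_poly l m)"
      using arg_cong[OF *[OF True], of degree] by (simp add: degree_mult_eq del: mult_pCons_left)
    with D(3) show ?thesis by simp
  qed (use D(3) in \<open>simp add: E_poly_def\<close>)
  show "ieval (E_poly l m) (- 1) \<noteq> 0" if "m mod 4 = 2"
    using ss *[OF that] by (intro has_simple_roots_square_free[of "[:1, 1:]"]) (simp_all add: map_poly_pCons)
qed

lemma irreducible_E_poly:
  assumes l: "l \<ge> 3" and m: "m \<ge> 3" and lm: "(int l - 2) * (int m - 2) > 4"
    and exc: "\<not> ((l = 3 \<and> m mod 12 = 4) \<or> (l = 3 \<and> m mod 6 = 3) \<or> (l = 3 \<and> m mod 20 = 5)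
      \<or> (l = 4 \<and> m mod 8 = 3) \<or> (l = 5 \<and> m mod 12 = 3))"
  shows "irreducible (map_poly of_int (E_poly l m) :: rat poly)"
proof -
  note E = E_poly_basic[OF l m lm]
  from D_poly_roots[OF l m lm] obtain x :: real where x: "has_simple_roots (D_poly l m)"
    "\<And>z. ieval (D_poly l m) z = 0 \<Longrightarrow> z = of_real x \<or> cmod z \<le> 1" by metis
  show ?thesis
  proof (rule irreducible_over_rat[where x = "of_real x"])
    show "degree (E_poly l m) > 0" "has_simple_roots (E_poly l m)"
      using E has_simple_roots_dvd[OF x(1)] by auto
    fix h assume h: "prime_elem h" "degree h > 0" "h dvd E_poly l m"
    show "ieval h (of_real x) = 0"
    proof (rule ccontr)
      assume hx: "ieval h (of_real x) \<noteq> 0"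
      have hD: "h dvd D_poly l m" using h(3) E(3) by (rule dvd_trans)
      \<comment> \<open>Kronecker's theorem is applied to the polynomial \<open>X\<close>, whose
        values are the roots themselves.\<close>
      have "cmod (ieval [:0, 1:] z) \<le> 1" if "ieval h z = 0" for z
        using x(2)[OF ieval_dvd[OF hD that]] that hx by (auto simp: map_poly_pCons)
      then have "h dvd [:0, 1:] \<or> (\<exists>N>0. h dvd [:0, 1:] ^ N - 1)"
        using h abs_lead_coeff_dvd[OF h(3) E(2)] has_simple_roots_dvd[OF x(1) hD]
        by (intro kronecker_dvd) auto
      moreover obtain z where z: "ieval h z = 0" using ieval_root_exists[OF h(2)] .
      have Dz: "ieval (D_poly l m) z = 0" using ieval_dvd[OF hD z] .
      \<comment> \<open>Zero is not a root, the constant coefficient of the denominator being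
        1.\<close>
      have "\<not> h dvd [:0, 1:]"
      proof
        assume "h dvd [:0, 1:]"
        from ieval_dvd[OF this z] have "z = 0" by (simp add: map_poly_pCons)
        with Dz D_poly_basic(2)[OF m, of l] show False by (simp add: poly_0_coeff_0 coeff_map_poly)
      qed
      ultimately obtain N where N: "N > 0" "h dvd [:0, 1:] ^ N - 1" by blast
      then have zN: "z ^ N = 1" using ieval_dvd[OF N(2) z] by (simp add: map_poly_of_int_hom)
      show False using m
      proof (cases m rule: nat_ge_3_cases)
        case (even w)
        then have "z = - 1" "odd w"
          using D_even_unity_root[of l w z N] l lm Dz zN N(1) exc by auto
        then have "m mod 4 = 2" using even by presburger
        with E(4) ieval_dvd[OF h(3) z] \<open>z = - 1\<close> show False by simp
      next
        case (odd w)
        then show False using D_odd_unity_root[of l w z N] l lm Dz zN N(1) exc by simp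
      qed
    qed
  qed
qed

section \<open>The exceptional factors\<close>

lemma unity_poly_divisor_dvd:
  assumes p: "p dvd monom 1 n - 1" "n > 0"
    and roots: "\<And>z. ieval p z = 0 \<Longrightarrow> z ^ n = 1 \<Longrightarrow> ieval f z = 0"
  shows "p dvd f"
proof (rule dvd_if_roots)
  show "has_simple_roots p" using has_simple_roots_dvd[OF has_simple_roots_unity[OF p(2)] p(1)] .
  have "lead_coeff (monom 1 n - 1 :: int poly) = 1" using p(2) by (simp add: degree_monom_minus_1)
  then show "\<bar>lead_coeff p\<bar> = 1" using abs_lead_coeff_dvd[OF p(1)] by simp
  show "ieval f z = 0" if "ieval p z = 0" for z
    using roots[OF that] ieval_dvd[OF p(1) that] by (simp add: map_poly_of_int_hom poly_monom)
qed

lemma power_mod_order: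
  fixes z :: complex
  assumes "z ^ n = 1"
  shows "z ^ w = z ^ (w mod n)"
proof -
  have "z ^ w = z ^ (n * (w div n) + w mod n)" by simp
  also have "\<dots> = z ^ (w mod n)" by (simp only: power_add power_mult assms) simp
  finally show ?thesis .
qed

text \<open>Only the residue of \<open>w\<close> modulo \<open>n\<close> matters, so each
  exceptional residue class reduces to one identity in \<open>z\<close>.\<close>

lemma D_even_root_mod:
  assumes "z ^ n = 1" "z \<noteq> 1" "w \<ge> 1" "t = z ^ (w mod n)"
    and "(z - 1) * (t + 1) = (of_nat l - 2) * (t - z)"
  shows "ieval (D_poly l (2 * w)) z = 0"
  using D_even_identity[OF assms(3), of z l] assms(2,4,5) power_mod_order[OF assms(1), of w] by simp

lemma D_odd_root_mod:
  assumes "z ^ n = 1" "z \<noteq> 1" "w \<ge> 1" "t = z ^ (w mod n)"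
    and "(z - 1) * (t + 1) ^ 2 = (of_nat l - 2) * (t ^ 2 - z)"
  shows "ieval (D_poly l (Suc (2 * w))) z = 0"
proof -
  have "z ^ (2 * w) = t ^ 2"
    using power_mod_order[OF assms(1), of w] assms(4) by (simp add: mult.commute power_mult)
  then show ?thesis
    using D_odd_identity[OF assms(3), of z l] assms(2,4,5) power_mod_order[OF assms(1), of w] by simp
qed

text \<open>These are the cyclotomic polynomials of orders 3, 4, 6 and 10. Dividing
  \<open>X^n - 1\<close> supplies their simple roots and unit leading coefficients.\<close>

lemma cyclotomic_factors:
  shows "[:1, 1, 1 :: int:] dvd monom 1 3 - 1"
    and "[:1, 0, 1 :: int:] dvd monom 1 4 - 1"
    and "[:1, -1, 1 :: int:] dvd monom 1 6 - 1"
    and "[:1, -1, 1, -1, 1 :: int:] dvd monom 1 10 - 1"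
proof -
  have "monom 1 3 - 1 = [:1, 1, 1 :: int:] * [:-1, 1:]"
    by (simp add: numeral_eq_Suc monom_Suc monom_0 one_pCons)
  then show "[:1, 1, 1 :: int:] dvd monom 1 3 - 1" by (rule dvdI)
  have "monom 1 4 - 1 = [:1, 0, 1 :: int:] * [:-1, 0, 1:]"
    by (simp add: numeral_eq_Suc monom_Suc monom_0 one_pCons)
  then show "[:1, 0, 1 :: int:] dvd monom 1 4 - 1" by (rule dvdI)
  have "monom 1 6 - 1 = [:1, -1, 1 :: int:] * [:-1, -1, 0, 1, 1:]"
    by (simp add: numeral_eq_Suc monom_Suc monom_0 one_pCons)
  then show "[:1, -1, 1 :: int:] dvd monom 1 6 - 1" by (rule dvdI)
  have "monom 1 10 - 1 = [:1, -1, 1, -1, 1 :: int:] * [:-1, -1, 0, 0, 0, 1, 1:]"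
    by (simp add: numeral_eq_Suc monom_Suc monom_0 one_pCons)
  then show "[:1, -1, 1, -1, 1 :: int:] dvd monom 1 10 - 1" by (rule dvdI)
qed

lemma E_poly_eq_D_poly: "m mod 4 \<noteq> 2 \<Longrightarrow> E_poly l m = D_poly l m"
  by (simp add: E_poly_def)

lemma E_poly_3_mod_12:
  assumes "m mod 12 = 4"
  shows "[:1, -1, 1:] dvd E_poly 3 m"
proof -
  \<comment> \<open>This is half of \<open>m\<close>, written so that its residue modulo 6, the
    order of the roots, is visible.\<close>
  define w where "w = 6 * (m div 12) + 2"
  have w2: "w mod 6 = 2" unfolding w_def mod_mult_self4 by simp
  have w: "m = 2 * w" "w \<ge> 1"
    using assms div_mult_mod_eq[of m 12] by (simp_all add: w_def)
  have "even w" by (simp add: w_def)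
  then have m4: "m mod 4 \<noteq> 2" using w(1) by presburger
  have "[:1, -1, 1:] dvd D_poly 3 (2 * w)"
  proof (rule unity_poly_divisor_dvd[OF cyclotomic_factors(3)])
    fix z assume "ieval [:1, -1, 1:] z = 0" and z6: "z ^ 6 = 1"
    then have ph: "1 - z + z ^ 2 = 0" by (simp add: map_poly_pCons algebra_simps power2_eq_square)
    then have "(z - 1) * (z ^ 2 + 1) = z ^ 2 - z" by algebra
    then show "ieval (D_poly 3 (2 * w)) z = 0"
      using w w2 ph by (intro D_even_root_mod[OF z6 _ _ refl]) auto
  qed simp
  then show ?thesis using w(1) m4 by (simp add: E_poly_eq_D_poly)
qed

lemma E_poly_odd_factor:
  assumes p: "p dvd monom 1 n - 1" "n > 0"
    and w: "w \<ge> 1" "w mod n = c"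
    and roots: "\<And>z. ieval p z = 0 \<Longrightarrow> z \<noteq> 1 \<and>
      (z - 1) * (z ^ c + 1) ^ 2 = (of_nat l - 2) * ((z ^ c) ^ 2 - z)"
  shows "p dvd E_poly l (Suc (2 * w))"
proof -
  have "p dvd D_poly l (Suc (2 * w))"
    using p
  proof (rule unity_poly_divisor_dvd)
    fix z assume "ieval p z = 0" "z ^ n = 1"
    then show "ieval (D_poly l (Suc (2 * w))) z = 0"
      using w roots by (intro D_odd_root_mod[of z n w "z ^ c"]) auto
  qed
  moreover have "Suc (2 * w) mod 4 \<noteq> 2" by presburger
  ultimately show ?thesis by (simp add: E_poly_eq_D_poly)
qed

lemma E_poly_3_mod_6:
  assumes "m mod 6 = 3"
  shows "[:1, 1, 1:] dvd E_poly 3 m"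
proof -
  define w where "w = 3 * (m div 6) + 1"
  have w2: "w mod 3 = 1" unfolding w_def mod_mult_self4 by simp
  have w: "m = Suc (2 * w)" "w \<ge> 1"
    using assms div_mult_mod_eq[of m 6] by (simp_all add: w_def)
  show ?thesis unfolding w(1)
  proof (rule E_poly_odd_factor[OF cyclotomic_factors(1) _ w(2) w2])
    fix z assume "ieval [:1, 1, 1:] z = 0"
    then have ph: "1 + z + z ^ 2 = 0" by (simp add: map_poly_pCons algebra_simps power2_eq_square)
    then have "(z - 1) * (z + 1) ^ 2 = z ^ 2 - z" by algebra
    then show "z \<noteq> 1 \<and> (z - 1) * (z ^ 1 + 1) ^ 2 = (of_nat 3 - 2) * ((z ^ 1) ^ 2 - z)"
      using ph by auto
  qed simp
qed

lemma E_poly_3_mod_20: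
  assumes "m mod 20 = 5"
  shows "[:1, -1, 1, -1, 1:] dvd E_poly 3 m"
proof -
  define w where "w = 10 * (m div 20) + 2"
  have w2: "w mod 10 = 2" unfolding w_def mod_mult_self4 by simp
  have w: "m = Suc (2 * w)" "w \<ge> 1"
    using assms div_mult_mod_eq[of m 20] by (simp_all add: w_def)
  show ?thesis unfolding w(1)
  proof (rule E_poly_odd_factor[OF cyclotomic_factors(4) _ w(2) w2])
    fix z assume "ieval [:1, -1, 1, -1, 1:] z = 0"
    then have ph: "1 - z + z ^ 2 - z ^ 3 + z ^ 4 = 0"
      by (simp add: map_poly_pCons algebra_simps power2_eq_square power3_eq_cube power4_eq_xxxx)
    then have "(z - 1) * (z ^ 2 + 1) ^ 2 = (z ^ 2) ^ 2 - z" by algebra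
    then show "z \<noteq> 1 \<and> (z - 1) * (z ^ 2 + 1) ^ 2 = (of_nat 3 - 2) * ((z ^ 2) ^ 2 - z)"
      using ph by auto
  qed simp
qed

lemma E_poly_4_mod_8:
  assumes "m mod 8 = 3"
  shows "[:1, 0, 1:] dvd E_poly 4 m"
proof -
  define w where "w = 4 * (m div 8) + 1"
  have w2: "w mod 4 = 1" unfolding w_def mod_mult_self4 by simp
  have w: "m = Suc (2 * w)" "w \<ge> 1"
    using assms div_mult_mod_eq[of m 8] by (simp_all add: w_def)
  show ?thesis unfolding w(1)
  proof (rule E_poly_odd_factor[OF cyclotomic_factors(2) _ w(2) w2])
    fix z assume "ieval [:1, 0, 1:] z = 0"
    then have ph: "1 + z ^ 2 = 0" by (simp add: map_poly_pCons algebra_simps power2_eq_square)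
    then have "(z - 1) * (z + 1) ^ 2 = 2 * (z ^ 2 - z)" by algebra
    then show "z \<noteq> 1 \<and> (z - 1) * (z ^ 1 + 1) ^ 2 = (of_nat 4 - 2) * ((z ^ 1) ^ 2 - z)"
      using ph by auto
  qed simp
qed

lemma E_poly_5_mod_12:
  assumes "m mod 12 = 3"
  shows "[:1, -1, 1:] dvd E_poly 5 m"
proof -
  define w where "w = 6 * (m div 12) + 1"
  have w2: "w mod 6 = 1" unfolding w_def mod_mult_self4 by simp
  have w: "m = Suc (2 * w)" "w \<ge> 1"
    using assms div_mult_mod_eq[of m 12] by (simp_all add: w_def)
  show ?thesis unfolding w(1)
  proof (rule E_poly_odd_factor[OF cyclotomic_factors(3) _ w(2) w2])
    fix z assume "ieval [:1, -1, 1:] z = 0"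
    then have ph: "1 - z + z ^ 2 = 0" by (simp add: map_poly_pCons algebra_simps power2_eq_square)
    then have "(z - 1) * (z + 1) ^ 2 = 3 * (z ^ 2 - z)" by algebra
    then show "z \<noteq> 1 \<and> (z - 1) * (z ^ 1 + 1) ^ 2 = (of_nat 5 - 2) * ((z ^ 1) ^ 2 - z)"
      using ph by auto
  qed simp
qed

theorem theorem1:
  fixes l m :: nat
  assumes "l \<ge> 3" and "m \<ge> 3" and "(int l - 2) * (int m - 2) > 4"
  shows "reciprocal_poly (D_poly l m) \<and> salem_poly (D_poly l m)
    \<and> (\<not> ((l = 3 \<and> m mod 12 = 4) \<or> (l = 3 \<and> m mod 6 = 3) \<or> (l = 3 \<and> m mod 20 = 5)
            \<or> (l = 4 \<and> m mod 8 = 3) \<or> (l = 5 \<and> m mod 12 = 3))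
         \<longrightarrow> irreducible (map_poly (of_int :: int \<Rightarrow> rat) (E_poly l m)))
    \<and> (l = 3 \<and> m mod 12 = 4 \<longrightarrow> [:1, -1, 1:] dvd E_poly l m)
    \<and> (l = 3 \<and> m mod 6 = 3 \<longrightarrow> [:1, 1, 1:] dvd E_poly l m)
    \<and> (l = 3 \<and> m mod 20 = 5 \<longrightarrow> [:1, -1, 1, -1, 1:] dvd E_poly l m)
    \<and> (l = 4 \<and> m mod 8 = 3 \<longrightarrow> [:1, 0, 1:] dvd E_poly l m)
    \<and> (l = 5 \<and> m mod 12 = 3 \<longrightarrow> [:1, -1, 1:] dvd E_poly l m)"
  using D_poly_basic(5)[OF assms(2)] salem_D_poly[OF assms] irreducible_E_poly[OF assms] assms(2)
    E_poly_3_mod_12 E_poly_3_mod_6 E_poly_3_mod_20 E_poly_4_mod_8 E_poly_5_mod_12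
  by blast

end
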